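(* Let $r\ge 1$ be an integer, let $a<b$, and let $0\le z_1<z_2<\cdots<z_r\le 1$ be fixed. Let $f\in C^r([a,b])$ satisfy either $f^{(r)}(x)>0$ for all $x\in[a,b]$ or $f^{(r)}(x)<0$ for all $x\in[a,b]$. Then, as $N\to+\infty$, $$\sqrt{\mathbb E\big(Sf-\overline M^{\,**}_{N,r}f\big)^2}\;\lessapprox\;K^*(r)\,c_r\,\sqrt{\alpha^2-\beta^2}\,\bigg(\int_a^b\big|f^{(r)}(x)\big|^{1/(r+1)}\,\mathrm dx\bigg)^{r+1}N^{-(r+1/2)},$$ where $$K^*(r)=\limsup_{m\to\infty}\;\max\Big\{K_{m,r}(A):\ A=(A_1,\dots,A_m),\ A_i>0,\ \max_{1\le i,j\le m}\frac{A_i}{A_j}\le 2^{r+1}\Big\}$$ and $$K_{m,r}(A)=\frac{\sqrt{\kappa_\alpha^2\,m\,\|A\|_2^2-\kappa_\beta^2\,\|A\|_1^2}}{\|A\|_{\frac1{r+1}}}\;m^r,\qquad \kappa_\alpha=\frac{\alpha}{\sqrt{\alpha^2-\beta^2}},\quad \kappa_\beta=\frac{\beta}{\sqrt{\alpha^2-\beta^2}}.$$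
   Context: Notation: $g_1(N)\lessapprox g_2(N)$ means $\limsup_{N\to\infty}g_1(N)/g_2(N)\le1$. $Sf=\int_a^b f(x)\,\mathrm dx$. For a vector $A=(A_1,\dots,A_m)$ with positive entries and $p>0$, $\|A\|_p=\big(\sum_{i=1}^mA_i^p\big)^{1/p}$. Put $P(z)=(z-z_1)\cdots(z-z_r)$, $\alpha=\big(\int_0^1|P(z)|^2\,\mathrm dz\big)^{1/2}$, $\beta=\int_0^1P(z)\,\mathrm dz$, and $$c_r=\begin{cases}\sqrt2\,\big(1-\frac1r\big)^r\,\dfrac{(r+1/2)^{r+1/2}}{r!}, & \text{if } r\ge 2,\ z_1=0,\ z_r=1,\\[2mm] \sqrt2\,\dfrac{(r+1/2)^{r+1/2}}{r!}, & \text{otherwise.}\end{cases}$$ Priority of an interval: for a subinterval $I\subseteq[a,b]$ of length $h$, $p_f(I)=h^{r+1}|d_I|$, where $d_I=f[x_{I,0},x_{I,1},\dots,x_{I,r}]$ is the divided difference of order $r$ of $f$ at arbitrarily chosen pairwise distinct points $x_{I,0},\dots,x_{I,r}\in I$ (fixed for each $I$). Procedure PARTITION (with parameter $m$): start with the collection consisting of the single interval $[a,b]$; repeat $m-1$ times: remove from the collection an interval $[l,u]$ with the highest priority $p_f$ (ties broken arbitrarily) and insert its two halves $[l,(l+u)/2]$ and $[(l+u)/2,u]$. The result is a partition of $[a,b]$ into $m$ subintervals $I_1,\dots,I_m$ with lengths $h_1,\dots,h_m$. The algorithm $\overline M^{\,**}_{N,r}$: given $N$, let $m=\lfloor m^*\rfloor$,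 $n=\lfloor n^*\rfloor$, where $$m^*=\frac{2r(N-1)}{(r-1)(2r+1)},\quad n^*=\frac{N-1}{2r+1}\qquad\text{if } r\ge2,\ z_1=0,\ z_r=1,$$ $$m^*=\frac{2N}{2r+1},\quad n^*=\frac{N}{2r+1}\qquad\text{otherwise}.$$ Let $I_1,\dots,I_m$ be the partition produced by PARTITION. Let $L_{m,r}f$ be the piecewise polynomial that on each $I_i=[y,y']$ is the Lagrange interpolation polynomial of $f$ of degree at most $r-1$ at the points $y+z_s(y'-y)$, $1\le s\le r$. Let $\varrho$ be the probability density on $[a,b]$ given by $\varrho(x)=\frac{1}{mh_i}$ for $x\in I_i$, $1\le i\le m$. Then $$\overline M^{\,**}_{N,r}f=\int_a^b(L_{m,r}f)(x)\,\mathrm dx+\frac1n\sum_{\ell=1}^n\frac{(f-L_{m,r}f)(t_\ell)}{\varrho(t_\ell)},$$ where $t_1,\dots,t_n$ are independent random points with density $\varrho$, and $\mathbb E$ is the expectation with respect to them. *)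

theory Defs
  imports "HOL-Probability.Probability"
begin

(* limsup g1(N)/g2(N) <= 1; the limsup is taken in the extended reals. *)
definition lessapprox :: "(nat \<Rightarrow> real) \<Rightarrow> (nat \<Rightarrow> real) \<Rightarrow> bool" where
  "lessapprox g1 g2 \<longleftrightarrow> limsup (\<lambda>N. ereal (g1 N / g2 N)) \<le> 1"

(* Iterated derivative relative to S: one-sided at the endpoints when S = [a,b], and independent
   of the values of f outside S at the points of S. *)
fun nderiv_on :: "real set \<Rightarrow> nat \<Rightarrow> (real \<Rightarrow> real) \<Rightarrow> real \<Rightarrow> real" where
  "nderiv_on S 0 f = f"
| "nderiv_on S (Suc k) f = (\<lambda>x. vector_derivative (nderiv_on S k f) (at x within S))"

definition C_on :: "nat \<Rightarrow> real set \<Rightarrow> (real \<Rightarrow> real) \<Rightarrow> bool" where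
  "C_on r S f \<longleftrightarrow>
     (\<forall>k<r. nderiv_on S k f differentiable_on S) \<and> continuous_on S (nderiv_on S r f)"

(* divdiff f x i k is the divided difference f[x_i, ..., x_(i+k)] of order k. *)
fun divdiff :: "(real \<Rightarrow> real) \<Rightarrow> (nat \<Rightarrow> real) \<Rightarrow> nat \<Rightarrow> nat \<Rightarrow> real" where
  "divdiff f x i 0 = f (x i)"
| "divdiff f x i (Suc k) = (divdiff f x (Suc i) k - divdiff f x i k) / (x (i + Suc k) - x i)"

definition lagrange :: "nat \<Rightarrow> (nat \<Rightarrow> real) \<Rightarrow> (real \<Rightarrow> real) \<Rightarrow> real \<Rightarrow> real" where
  "lagrange r x f t =
     (\<Sum>s=1..r. f (x s) * (\<Prod>j\<in>{1..r} - {s}. (t - x j) / (x s - x j)))"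

(* An interval [l,u] is encoded as the pair (l,u) of its endpoints. *)
type_synonym ivl = "real \<times> real"

definition len :: "ivl \<Rightarrow> real" where
  "len I = snd I - fst I"

(* pts I 0, ..., pts I r are the points chosen in I for the divided difference d_I. *)
definition priority :: "nat \<Rightarrow> (ivl \<Rightarrow> nat \<Rightarrow> real) \<Rightarrow> (real \<Rightarrow> real) \<Rightarrow> ivl \<Rightarrow> real" where
  "priority r pts f I = len I ^ (r + 1) * \<bar>divdiff f (pts I) 0 r\<bar>"

(* The possible results of the bisection procedure started from [a,b], with a parameter m and the
   priority function p. It is a relation rather than a function since ties between intervals of
   highest priority are broken arbitrarily. *)
inductive partition_result :: "(ivl \<Rightarrow> real) \<Rightarrow> real \<Rightarrow> real \<Rightarrow> nat \<Rightarrow> ivl set \<Rightarrow> bool"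
  for p :: "ivl \<Rightarrow> real" and a b :: real where
  start: "partition_result p a b 1 {(a, b)}"
| split: "\<lbrakk>partition_result p a b m Q; (l, u) \<in> Q; \<forall>I\<in>Q. p I \<le> p (l, u)\<rbrakk> \<Longrightarrow>
    partition_result p a b (Suc m) ((Q - {(l, u)}) \<union> {(l, (l + u) / 2), ((l + u) / 2, u)})"

(* At an interior breakpoint of the partition two intervals qualify and either may be picked; this
   affects only the values of the functions below on a finite set. *)
definition cell :: "ivl set \<Rightarrow> real \<Rightarrow> ivl" where
  "cell Q x = (SOME I. I \<in> Q \<and> x \<in> {fst I..snd I})"

definition pw_lagrange ::
    "nat \<Rightarrow> (nat \<Rightarrow> real) \<Rightarrow> ivl set \<Rightarrow> (real \<Rightarrow> real) \<Rightarrow> real \<Rightarrow> real" where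
  "pw_lagrange r z Q f x =
     (let I = cell Q x in lagrange r (\<lambda>s. fst I + z s * len I) f x)"

definition rho :: "real \<Rightarrow> real \<Rightarrow> nat \<Rightarrow> ivl set \<Rightarrow> real \<Rightarrow> real" where
  "rho a b m Q x = (if x \<in> {a..b} then 1 / (real m * len (cell Q x)) else 0)"

abbreviation both_endpoints :: "nat \<Rightarrow> (nat \<Rightarrow> real) \<Rightarrow> bool" where
  "both_endpoints r z \<equiv> r \<ge> 2 \<and> z 1 = 0 \<and> z r = 1"

(* For the finitely many N with m* < 0, n* < 0 the conversion nat yields 0. *)
definition m_of :: "nat \<Rightarrow> (nat \<Rightarrow> real) \<Rightarrow> nat \<Rightarrow> nat" where
  "m_of r z N = nat \<lfloor>if both_endpoints r z
     then 2 * real r * (real N - 1) / ((real r - 1) * (2 * real r + 1))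
     else 2 * real N / (2 * real r + 1)\<rfloor>"

definition n_of :: "nat \<Rightarrow> (nat \<Rightarrow> real) \<Rightarrow> nat \<Rightarrow> nat" where
  "n_of r z N = nat \<lfloor>if both_endpoints r z
     then (real N - 1) / (2 * real r + 1)
     else real N / (2 * real r + 1)\<rfloor>"

(* The value of the algorithm for the partition Q into m intervals and the sample points
   t 1, ..., t n. *)
definition M_alg :: "nat \<Rightarrow> (nat \<Rightarrow> real) \<Rightarrow> real \<Rightarrow> real \<Rightarrow> nat \<Rightarrow> nat \<Rightarrow> ivl set \<Rightarrow>
    (real \<Rightarrow> real) \<Rightarrow> (nat \<Rightarrow> real) \<Rightarrow> real" where
  "M_alg r z a b m n Q f t =
     integral {a..b} (pw_lagrange r z Q f) +
     1 / real n * (\<Sum>l=1..n. (f (t l) - pw_lagrange r z Q f (t l)) / rho a b m Q (t l))"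

definition P_poly :: "nat \<Rightarrow> (nat \<Rightarrow> real) \<Rightarrow> real \<Rightarrow> real" where
  "P_poly r z x = (\<Prod>s=1..r. x - z s)"

definition alpha :: "nat \<Rightarrow> (nat \<Rightarrow> real) \<Rightarrow> real" where
  "alpha r z = sqrt (integral {0..1} (\<lambda>x. \<bar>P_poly r z x\<bar>\<^sup>2))"

definition beta :: "nat \<Rightarrow> (nat \<Rightarrow> real) \<Rightarrow> real" where
  "beta r z = integral {0..1} (P_poly r z)"

definition c_const :: "nat \<Rightarrow> (nat \<Rightarrow> real) \<Rightarrow> real" where
  "c_const r z = (if both_endpoints r z
     then sqrt 2 * (1 - 1 / real r) ^ r * ((real r + 1/2) powr (real r + 1/2) / fact r)
     else sqrt 2 * ((real r + 1/2) powr (real r + 1/2) / fact r))"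

definition kappa_alpha :: "nat \<Rightarrow> (nat \<Rightarrow> real) \<Rightarrow> real" where
  "kappa_alpha r z = alpha r z / sqrt ((alpha r z)\<^sup>2 - (beta r z)\<^sup>2)"

definition kappa_beta :: "nat \<Rightarrow> (nat \<Rightarrow> real) \<Rightarrow> real" where
  "kappa_beta r z = beta r z / sqrt ((alpha r z)\<^sup>2 - (beta r z)\<^sup>2)"

definition pnorm :: "nat \<Rightarrow> real \<Rightarrow> (nat \<Rightarrow> real) \<Rightarrow> real" where
  "pnorm m p A = (\<Sum>i=1..m. A i powr p) powr (1 / p)"

definition K_mr :: "nat \<Rightarrow> (nat \<Rightarrow> real) \<Rightarrow> nat \<Rightarrow> (nat \<Rightarrow> real) \<Rightarrow> real" where
  "K_mr r z m A =
     sqrt ((kappa_alpha r z)\<^sup>2 * real m * (pnorm m 2 A)\<^sup>2 - (kappa_beta r z)\<^sup>2 * (pnorm m 1 A)\<^sup>2)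
       / pnorm m (1 / (real r + 1)) A * real m ^ r"

definition admissible :: "nat \<Rightarrow> nat \<Rightarrow> (nat \<Rightarrow> real) set" where
  "admissible r m = {A. (\<forall>i\<in>{1..m}. A i > 0) \<and> (\<forall>i\<in>{1..m}. \<forall>j\<in>{1..m}. A i / A j \<le> 2 ^ (r + 1))}"

(* The supremum is a maximum for m >= 1: K_mr is invariant under scaling of A, so A may be
   restricted to a compact set. *)
definition K_star_ereal :: "nat \<Rightarrow> (nat \<Rightarrow> real) \<Rightarrow> ereal" where
  "K_star_ereal r z = limsup (\<lambda>m. SUP A\<in>admissible r m. ereal (K_mr r z m A))"

(* No information is lost here, see K_star_finite. *)
definition K_star :: "nat \<Rightarrow> (nat \<Rightarrow> real) \<Rightarrow> real" where
  "K_star r z = real_of_ereal (K_star_ereal r z)"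

lemma K_mr_const:
  assumes "m \<ge> 1"
  shows "K_mr r z m (\<lambda>_. 1) = sqrt ((kappa_alpha r z)\<^sup>2 - (kappa_beta r z)\<^sup>2)"
proof -
  have p: "pnorm m p (\<lambda>_. 1) = real m powr (1 / p)" for p
    by (simp add: pnorm_def)
  have "K_mr r z m (\<lambda>_. 1) =
      sqrt ((real m)\<^sup>2 * ((kappa_alpha r z)\<^sup>2 - (kappa_beta r z)\<^sup>2)) / real m powr (real r + 1) * real m ^ r"
    using assms by (simp add: K_mr_def p powr_half_sqrt algebra_simps power2_eq_square)
  also have "real m powr (real r + 1) = real m ^ (r + 1)"
    using assms powr_realpow[of "real m" "r + 1"] by (simp add: add.commute)
  finally show ?thesis
    using assms by (simp add: real_sqrt_mult)
qed

lemma K_mr_le: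
  assumes m: "m \<ge> 1" and A: "A \<in> admissible r m"
  shows "K_mr r z m A \<le> \<bar>kappa_alpha r z\<bar> * (2 ^ (r + 1))\<^sup>2"
proof -
  define c :: real where "c = 2 ^ (r + 1)"
  define q where "q = 1 / (real r + 1)"
  have c: "c > 0" and q: "q > 0" by (auto simp: c_def q_def)
  have pos: "A i > 0" if "i \<in> {1..m}" for i
    using A that by (auto simp: admissible_def)
  have A1: "A 1 > 0" using pos m by auto
  have up: "A i \<le> c * A 1" and lo: "A 1 / c \<le> A i" if "i \<in> {1..m}" for i
  proof -
    have "A i / A 1 \<le> c" "A 1 / A i \<le> c"
      using A that m by (auto simp: admissible_def c_def)
    then show "A i \<le> c * A 1" "A 1 / c \<le> A i"
      using pos[OF that] A1 c by (auto simp: field_simps)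
  qed
  have "(pnorm m 2 A)\<^sup>2 = (\<Sum>i=1..m. A i powr 2)"
    by (simp add: pnorm_def powr_half_sqrt sum_nonneg)
  also have "\<dots> \<le> (\<Sum>i=1..m. (c * A 1) powr 2)"
    using up pos by (intro sum_mono powr_mono2) (auto intro: less_imp_le)
  also have "\<dots> = real m * (c * A 1)\<^sup>2"
    using c A1 by (simp add: powr_numeral)
  finally have n2: "(pnorm m 2 A)\<^sup>2 \<le> real m * (c * A 1)\<^sup>2" .
  have "(real m * (A 1 / c) powr q) powr (1 / q) \<le> pnorm m q A"
  proof -
    have "real m * (A 1 / c) powr q = (\<Sum>i=1..m. (A 1 / c) powr q)" by simp
    also have "\<dots> \<le> (\<Sum>i=1..m. A i powr q)"
      using lo A1 c q by (intro sum_mono powr_mono2) auto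
    finally show ?thesis
      unfolding pnorm_def using q by (intro powr_mono2) auto
  qed
  also have "(real m * (A 1 / c) powr q) powr (1 / q) = real m ^ (r + 1) * (A 1 / c)"
  proof -
    have "(real m * (A 1 / c) powr q) powr (1 / q) = real m powr (real (r + 1)) * (A 1 / c)"
      using q A1 c m by (simp add: powr_mult powr_powr q_def add.commute)
    then show ?thesis using m by (subst (asm) powr_realpow) auto
  qed
  finally have nq: "real m ^ (r + 1) * (A 1 / c) \<le> pnorm m q A" .
  define ka where "ka = kappa_alpha r z"
  have "sqrt (ka\<^sup>2 * real m * (pnorm m 2 A)\<^sup>2 - (kappa_beta r z)\<^sup>2 * (pnorm m 1 A)\<^sup>2)
      \<le> sqrt (ka\<^sup>2 * real m * (real m * (c * A 1)\<^sup>2))"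
    using n2 by (intro real_sqrt_le_mono order_trans[OF _ mult_left_mono[OF n2]]) auto
  also have "ka\<^sup>2 * real m * (real m * (c * A 1)\<^sup>2) = (\<bar>ka\<bar> * real m * (c * A 1))\<^sup>2"
    by (simp add: power_mult_distrib power2_eq_square)
  also have "sqrt \<dots> = \<bar>ka\<bar> * real m * (c * A 1)"
    using c A1 by simp
  finally have s: "sqrt (ka\<^sup>2 * real m * (pnorm m 2 A)\<^sup>2 - (kappa_beta r z)\<^sup>2 * (pnorm m 1 A)\<^sup>2)
      \<le> \<bar>ka\<bar> * real m * (c * A 1)" .
  have d: "0 < real m ^ (r + 1) * (A 1 / c)" using m A1 c by simp
  have "K_mr r z m A \<le> \<bar>ka\<bar> * real m * (c * A 1) / (real m ^ (r + 1) * (A 1 / c)) * real m ^ r"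
    unfolding K_mr_def ka_def[symmetric] q_def[symmetric]
    using s nq d c A1 by (intro mult_right_mono frac_le) auto
  also have "\<dots> = \<bar>ka\<bar> * c\<^sup>2"
    using m A1 c by (simp add: field_simps power2_eq_square)
  finally show ?thesis by (simp add: ka_def c_def)
qed

lemma K_star_finite: "\<bar>K_star_ereal r z\<bar> \<noteq> \<infinity>"
proof -
  let ?S = "\<lambda>m. SUP A\<in>admissible r m. ereal (K_mr r z m A)"
  let ?u = "ereal (\<bar>kappa_alpha r z\<bar> * (2 ^ (r + 1))\<^sup>2)"
  let ?l = "ereal (sqrt ((kappa_alpha r z)\<^sup>2 - (kappa_beta r z)\<^sup>2))"
  have "limsup ?S \<le> ?u"
    by (intro Limsup_bounded eventually_sequentiallyI[of 1] SUP_least)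
       (simp only: ereal_less_eq K_mr_le)
  moreover have "?l \<le> limsup ?S"
  proof (rule le_Limsup)
    show "eventually (\<lambda>m. ?l \<le> ?S m) sequentially"
    proof (rule eventually_sequentiallyI[of 1])
      fix m :: nat assume m: "1 \<le> m"
      have "(1::real) \<le> 2 ^ (r + 1)" by (rule one_le_power) simp
      then have "(\<lambda>_. 1) \<in> admissible r m"
        by (auto simp: admissible_def)
      then show "?l \<le> ?S m"
        by (intro SUP_upper2[of "\<lambda>_. 1"]) (simp_all add: K_mr_const[OF m])
    qed
  qed simp
  ultimately show ?thesis
    unfolding K_star_ereal_def by (cases "limsup ?S") auto
qed

end

theory Submission
  imports Defs "HOL-Real_Asymp.Real_Asymp"
begin

text \<open>
  Fix the partition into \<open>m\<close> cells \<open>I\<close> of lengths \<open>h\<^sub>I\<close> and let \<open>e\<close> be the interpolation error. The algorithm adds to the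
  integral of the interpolant the mean of \<open>n\<close> independent copies of \<open>e(t) / \<rho>(t)\<close>, whose expectation is
  the integral of \<open>e\<close>. Since \<open>\<rho> = 1 / (m h\<^sub>I)\<close> on \<open>I\<close>, the mean square error is \<open>1 / n\<close> times
  \<open>m \<Sum>\<^sub>I h\<^sub>I \<integral>\<^sub>I e\<^sup>2 - (\<Sum>\<^sub>I \<integral>\<^sub>I e)\<^sup>2\<close> (\<open>mean_square_error_le\<close>).

  On a short cell the derivative of order \<open>r\<close> is nearly constant, so \<open>e\<close> is nearly a multiple of the nodal polynomial:
  with \<open>A\<^sub>I = h\<^sub>I\<^bsup>r+1\<^esup> v\<^sub>I\<close>, where \<open>v\<^sub>I\<close> is close to \<open>\<bar>f\<^sup>(\<^sup>r\<^sup>)\<bar> / r!\<close> on \<open>I\<close>, the integrals of \<open>e\<^sup>2\<close> and \<open>e\<close>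
  over \<open>I\<close> are nearly \<open>\<alpha>\<^sup>2 A\<^sub>I\<^sup>2 / h\<^sub>I\<close> and \<open>\<plusminus>\<beta> A\<^sub>I\<close>, with the same sign on all cells
  (\<open>cell_error_bounds\<close>). The mean square error is therefore nearly \<open>1 / n\<close> times
  \<open>\<alpha>\<^sup>2 m \<Sum> A\<^sub>I\<^sup>2 - \<beta>\<^sup>2 (\<Sum> A\<^sub>I)\<^sup>2\<close>, and this is what \<^const>\<open>K_mr\<close> of the vector \<open>A\<close> measures, relative to the
  norm of \<open>A\<close> with exponent \<open>1 / (r + 1)\<close> (\<open>K_mr_of_cells\<close>). That norm is the power of a Riemann sum and is at most slightly
  larger than \<open>1 / r!\<close> times the power of the integral in the claim (\<open>cell_norm_le_integral\<close>).

  The bound \<open>K_star\<close> applies if the entries of \<open>A\<close> differ at most by the factor \<open>2\<^bsup>r+1\<^esup>\<close>. This is the effect of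
  always halving a cell of highest priority. First, priorities are comparable to \<open>h\<^sub>I\<^bsup>r+1\<^esup>\<close>, because the divided
  differences are values of \<open>f\<^sup>(\<^sup>r\<^sup>) / r!\<close>, so the lengths within one partition stay comparable and tend to zero
  (\<open>partition_result_quasi_uniform\<close>). Once they are short, each halving divides the priority by almost exactly \<open>2\<^bsup>r+1\<^esup>\<close>, so
  that priorities differ at most by slightly more than this factor (\<open>partition_result_priorities\<close>). The excess is removed by
  adjusting the values \<open>v\<^sub>I\<close> slightly (\<open>partition_result_balanced\<close>).

  All perturbations are controlled by one number \<open>\<epsilon>\<close> that can be taken arbitrarily small as \<open>m\<close> grows. Because
  \<open>K_star \<ge> 1\<close>, additive errors of order \<open>\<epsilon>\<close> are also relatively small. The limit in \<open>N\<close> and then in \<open>\<epsilon>\<close>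
  gives the theorem, the constant \<^const>\<open>c_const\<close> being the limit of \<open>N\<^bsup>r+1/2\<^esup> / (r! m\<^sup>r n\<^bsup>1/2\<^esup>)\<close>.
\<close>

section \<open>Rolle's theorem and the two mean value formulas\<close>

lemma nderiv_on_has_derivative:
  assumes "C_on r S f" "k < r" "x \<in> S"
  shows "(nderiv_on S k f has_real_derivative nderiv_on S (Suc k) f x) (at x within S)"
proof -
  have "nderiv_on S k f differentiable (at x within S)"
    using assms by (auto simp: C_on_def differentiable_on_def)
  then show ?thesis
    by (simp add: vector_derivative_works[symmetric] has_real_derivative_iff_has_vector_derivative)
qed

lemma C_on_continuous:
  assumes "C_on r S f" "k \<le> r"
  shows "continuous_on S (nderiv_on S k f)"
proof (cases "k = r")
  case True
  then show ?thesis using assms by (auto simp: C_on_def)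
next
  case False
  then show ?thesis
    using assms by (auto simp: C_on_def intro!: differentiable_imp_continuous_on)
qed

text \<open>
  Between consecutive zeros of \<open>g\<close> there is a zero of \<open>g'\<close>; keeping the new zeros below the largest old one
  makes the induction, which removes that one, produce distinct points.
\<close>

lemma Rolle_zeros:
  fixes g g' :: "real \<Rightarrow> real"
  assumes "card X = Suc n" "X \<subseteq> {l..u}" "\<And>x. x \<in> X \<Longrightarrow> g x = 0"
    and cont: "continuous_on {l..u} g"
    and deriv: "\<And>x. l < x \<Longrightarrow> x < u \<Longrightarrow> (g has_real_derivative g' x) (at x)"
  shows "\<exists>Y\<subseteq>{l..Max X}. card Y = n \<and> finite Y \<and> (\<forall>y\<in>Y. y < Max X \<and> g' y = 0)"
  using assms(1-3)
proof (induction n arbitrary: X)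
  case 0
  show ?case by (intro exI[of _ "{}"]) auto
next
  case (Suc n)
  have fin: "finite X" using Suc.prems(1) card.infinite by fastforce
  define M where "M = Max X"
  define X' where "X' = X - {M}"
  have "X \<noteq> {}" using Suc.prems(1) by auto
  then have M: "M \<in> X" "\<And>x. x \<in> X \<Longrightarrow> x \<le> M" using fin by (auto simp: M_def)
  have card': "card X' = Suc n" using M Suc.prems(1) fin by (simp add: X'_def)
  then obtain Y where Y: "Y \<subseteq> {l..Max X'}" "card Y = n" "finite Y"
      "\<forall>y\<in>Y. y < Max X' \<and> g' y = 0"
    using Suc.IH[of X'] Suc.prems by (auto simp: X'_def)
  define M' where "M' = Max X'"
  have "X' \<noteq> {}" using card' by force
  moreover have "finite X'" using fin by (simp add: X'_def)
  ultimately
  have M': "M' \<in> X'" by (simp add: M'_def)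
  then have less: "M' < M" using M(2)[of M'] by (auto simp: X'_def)
  have bounds: "l \<le> M'" "M \<le> u" using M' M(1) Suc.prems(2) by (auto simp: X'_def)
  obtain y where y: "M' < y" "y < M" "g' y = 0"
  proof -
    have "\<exists>z. M' < z \<and> z < M \<and> (*) (g' z) = (\<lambda>v. 0)"
    proof (rule Rolle_deriv[OF less])
      show "g M' = g M" using M' M(1) Suc.prems(3) by (auto simp: X'_def)
      show "continuous_on {M'..M} g" using bounds by (intro continuous_on_subset[OF cont]) auto
    qed (use bounds deriv in \<open>auto simp: has_field_derivative_def\<close>)
    then obtain z where z: "M' < z" "z < M" "(*) (g' z) = (\<lambda>v. 0)" by blast
    have "g' z * 1 = 0" using fun_cong[OF z(3)] .
    then show ?thesis using that z(1,2) by simp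
  qed
  have "y \<notin> Y" using Y(4) y(1) by (auto simp: M'_def)
  then have "card (insert y Y) = Suc n" using Y by simp
  moreover have "insert y Y \<subseteq> {l..M}" using Y y bounds less by (fastforce simp: M'_def)
  moreover have "\<forall>y\<in>insert y Y. y < M \<and> g' y = 0" using Y y less by (auto simp: M'_def)
  ultimately show ?case using Y(3) unfolding M_def by (intro exI[of _ "insert y Y"]) auto
qed

text \<open>
  Both mean value formulas below are instances of this one: a function that agrees with a polynomial
  of degree at most \<open>r\<close> at \<open>r + 1\<close> points shares with it a value of the derivative of order \<open>r\<close>,
  since Rolle's theorem can be applied \<open>r\<close> times to the difference.
\<close>

lemma interpolation_mean_value:
  fixes f :: "real \<Rightarrow> real" and p :: "real poly"
  assumes C: "C_on r {a..b} f" and lu: "a \<le> l" "u \<le> b" and deg: "degree p \<le> r"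
    and X: "card X = Suc r" "X \<subseteq> {l..u}" "\<And>x. x \<in> X \<Longrightarrow> f x = poly p x"
  shows "\<exists>\<xi>\<in>{l..u}. nderiv_on {a..b} r f \<xi> = fact r * coeff p r"
proof -
  define g where "g k x = nderiv_on {a..b} k f x - poly ((pderiv ^^ k) p) x" for k x
  have "\<exists>Y\<subseteq>{l..u}. card Y = Suc r - k \<and> (\<forall>x\<in>Y. g k x = 0)" if "k \<le> r" for k
    using that
  proof (induction k)
    case 0
    then show ?case using X by (intro exI[of _ X]) (auto simp: g_def)
  next
    case (Suc k)
    then obtain Y where Y: "Y \<subseteq> {l..u}" "card Y = Suc (r - k)" "\<forall>x\<in>Y. g k x = 0"
      by (auto simp: Suc_diff_le)
    have "finite Y" "Y \<noteq> {}" using Y(2) card.infinite by fastforce+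
    then have "Max Y \<le> u" using Y(1) by auto
    have cont: "continuous_on {l..u} (g k)"
      unfolding g_def using Suc.prems lu
      by (intro continuous_intros continuous_on_subset[OF C_on_continuous[OF C]]) auto
    have deriv: "(g k has_real_derivative g (Suc k) x) (at x)" if "l < x" "x < u" for x
    proof -
      have "(nderiv_on {a..b} k f has_real_derivative nderiv_on {a..b} (Suc k) f x)
          (at x within {a..b})"
        using C Suc.prems that lu by (intro nderiv_on_has_derivative) auto
      also have "at x within {a..b} = at x"
        using that lu by (intro at_within_interior) auto
      finally show ?thesis
        unfolding g_def by (auto intro!: derivative_eq_intros simp del: nderiv_on.simps)
    qed
    obtain Z where "Z \<subseteq> {l..Max Y}" "card Z = r - k" "\<forall>y\<in>Z. y < Max Y \<and> g (Suc k) y = 0"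
      using Rolle_zeros[OF Y(2,1) _ cont deriv] Y(3) by auto
    then show ?case using \<open>Max Y \<le> u\<close> by (intro exI[of _ Z]) fastforce
  qed
  from this[of r] obtain Y where Y: "Y \<subseteq> {l..u}" "card Y = 1" "\<forall>x\<in>Y. g r x = 0" by auto
  then obtain \<xi> where \<xi>: "\<xi> \<in> {l..u}" "g r \<xi> = 0" by (auto simp: card_1_singleton_iff)
  have "degree ((pderiv ^^ r) p) = 0" using deg by (simp add: degree_higher_pderiv)
  then obtain c where "(pderiv ^^ r) p = [:c:]" by (rule degree_eq_zeroE)
  then have "poly ((pderiv ^^ r) p) \<xi> = coeff ((pderiv ^^ r) p) 0" by simp
  also have "\<dots> = fact r * coeff p r"
    by (simp add: coeff_higher_pderiv pochhammer_fact)
  finally show ?thesis using \<xi> by (auto simp: g_def)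
qed

text \<open>
  The recursion of the divided differences is the comparison of leading coefficients in the
  Aitken--Neville recursion for interpolation polynomials.
\<close>

lemma divdiff_interpolation:
  assumes "inj_on x {i..i + k}"
  shows "\<exists>p. degree p \<le> k \<and> coeff p k = divdiff f x i k \<and> (\<forall>j\<in>{i..i + k}. poly p (x j) = f (x j))"
  using assms
proof (induction k arbitrary: i)
  case 0
  show ?case by (intro exI[of _ "[:f (x i):]"]) auto
next
  case (Suc k)
  obtain p where p: "degree p \<le> k" "coeff p k = divdiff f x i k"
      "\<forall>j\<in>{i..i + k}. poly p (x j) = f (x j)"
    using Suc.IH[of i] inj_on_subset[OF Suc.prems] by fastforce
  obtain q where q: "degree q \<le> k" "coeff q k = divdiff f x (Suc i) k"
      "\<forall>j\<in>{Suc i..Suc i + k}. poly q (x j) = f (x j)"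
    using Suc.IH[of "Suc i"] inj_on_subset[OF Suc.prems] by fastforce
  define c where "c = x (i + Suc k) - x i"
  have c: "c \<noteq> 0" using inj_onD[OF Suc.prems, of "i + Suc k" i] by (auto simp: c_def)
  define s where "s = smult (1 / c) ([:- x i, 1:] * q - [:- x (i + Suc k), 1:] * p)"
  have "degree ([:y, 1:] * h) \<le> Suc k" if "degree h \<le> k" for y and h :: "real poly"
    by (rule order_trans[OF degree_mult_le]) (use that in simp)
  then have "degree s \<le> Suc k"
    unfolding s_def using p(1) q(1) by (intro order_trans[OF degree_smult_le] degree_diff_le)
  moreover have "coeff p (Suc k) = 0" "coeff q (Suc k) = 0"
    using p(1) q(1) by (auto intro!: coeff_eq_0)
  then have "coeff s (Suc k) = divdiff f x i (Suc k)"
    by (simp add: s_def c_def p(2) q(2))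
  moreover have "poly s (x j) = f (x j)" if j: "j \<in> {i..i + Suc k}" for j
  proof -
    have eq: "poly s (x j) = ((x j - x i) * poly q (x j) - (x j - x (i + Suc k)) * poly p (x j)) / c"
      unfolding s_def poly_smult poly_diff poly_mult by simp
    consider "j = i" | "j = i + Suc k" | "j \<in> {Suc i..i + k}"
      using j by force
    then show ?thesis
    proof cases
      case 1
      have "poly p (x j) = f (x j)" "x j - x (i + Suc k) = - c" using p(3) 1 by (auto simp: c_def)
      then show ?thesis using c unfolding eq by (simp add: 1)
    next
      case 2
      have "poly q (x j) = f (x j)" using q(3) 2 by auto
      then show ?thesis using c unfolding eq by (simp add: c_def 2)
    next
      case 3
      have "poly p (x j) = f (x j)" "poly q (x j) = f (x j)" using p(3) q(3) 3 by auto
      then show ?thesis using c unfolding eq by (simp add: c_def field_simps)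
    qed
  qed
  ultimately show ?case by blast
qed

lemma divdiff_mean_value:
  assumes "C_on r {a..b} f" "a \<le> l" "u \<le> b" "inj_on x {0..r}" "x ` {0..r} \<subseteq> {l..u}"
  shows "\<exists>\<xi>\<in>{l..u}. divdiff f x 0 r = nderiv_on {a..b} r f \<xi> / fact r"
proof -
  obtain p where p: "degree p \<le> r" "coeff p r = divdiff f x 0 r"
      "\<forall>j\<in>{0..0 + r}. poly p (x j) = f (x j)"
    using divdiff_interpolation[of x 0 r f] assms(4) by auto
  have "card (x ` {0..r}) = Suc r" using assms(4) by (simp add: card_image)
  moreover have "f y = poly p y" if "y \<in> x ` {0..r}" for y using p(3) that by auto
  ultimately obtain \<xi> where "\<xi> \<in> {l..u}" "nderiv_on {a..b} r f \<xi> = fact r * coeff p r"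
    using interpolation_mean_value[OF assms(1-3) p(1) _ assms(5)] by blast
  then show ?thesis using p(2) by (intro bexI[of _ \<xi>]) auto
qed

lemma lagrange_eq_poly: "\<exists>p. degree p \<le> r - 1 \<and> (\<forall>t. lagrange r x f t = poly p t)"
proof -
  define p where "p = (\<Sum>s=1..r. smult (f (x s)) (\<Prod>j\<in>{1..r} - {s}. smult (1 / (x s - x j)) [:- x j, 1:]))"
  have "degree (\<Prod>j\<in>{1..r} - {s}. smult (1 / (x s - x j)) [:- x j, 1:]) \<le> r - 1" if "s \<in> {1..r}" for s
  proof -
    have "degree (\<Prod>j\<in>{1..r} - {s}. smult (1 / (x s - x j)) [:- x j, 1:])
        \<le> (\<Sum>j\<in>{1..r} - {s}. 1)"
      by (intro order_trans[OF degree_prod_sum_le] sum_mono) auto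
    also have "\<dots> = r - 1" using that by simp
    finally show ?thesis .
  qed
  then have "degree p \<le> r - 1"
    unfolding p_def by (intro degree_sum_le order_trans[OF degree_smult_le]) auto
  moreover have "lagrange r x f t = poly p t" for t
    by (auto simp: lagrange_def p_def poly_sum poly_prod diff_divide_distrib intro!: sum.cong prod.cong)
  ultimately show ?thesis by (intro exI[of _ p]) auto
qed

lemma lagrange_node:
  assumes "inj_on x {1..r}" "k \<in> {1..r}"
  shows "lagrange r x f (x k) = f (x k)"
proof -
  have "lagrange r x f (x k) = (\<Sum>s=1..r. if s = k then f (x k) else 0)"
    unfolding lagrange_def
  proof (intro sum.cong refl)
    fix s assume s: "s \<in> {1..r}"
    show "f (x s) * (\<Prod>j\<in>{1..r} - {s}. (x k - x j) / (x s - x j)) = (if s = k then f (x k) else 0)"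
    proof (cases "s = k")
      case True
      have "x k \<noteq> x j" if "j \<in> {1..r} - {k}" for j
        using that assms inj_onD[OF assms(1), of k j] by auto
      then have "(\<Prod>j\<in>{1..r} - {k}. (x k - x j) / (x k - x j)) = 1"
        by (intro prod.neutral) auto
      with True show ?thesis by simp
    next
      case False
      then have "(\<Prod>j\<in>{1..r} - {s}. (x k - x j) / (x s - x j)) = 0"
        using assms(2) by (intro prod_zero) (auto intro!: bexI[of _ k])
      with False show ?thesis by simp
    qed
  qed
  also have "\<dots> = f (x k)" using assms(2) by simp
  finally show ?thesis .
qed

text \<open>
  At a node both sides vanish. Elsewhere the error at \<open>t\<close> is the value at \<open>t\<close> of a multiple of the nodal
  polynomial, and this multiple is the leading coefficient of the interpolant at the nodes and at \<open>t\<close>.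
\<close>

lemma lagrange_error:
  assumes C: "C_on r {a..b} f" and lu: "a \<le> l" "u \<le> b" and r: "r \<ge> 1"
    and x: "inj_on x {1..r}" "x ` {1..r} \<subseteq> {l..u}" and t: "t \<in> {l..u}"
  shows "\<exists>\<xi>\<in>{l..u}. f t - lagrange r x f t = (\<Prod>s=1..r. t - x s) * (nderiv_on {a..b} r f \<xi> / fact r)"
proof (cases "t \<in> x ` {1..r}")
  case True
  then obtain k where k: "k \<in> {1..r}" "t = x k" by auto
  have "(\<Prod>s=1..r. x k - x s) = 0" using k(1) by (intro prod_zero) auto
  then show ?thesis using k x(1) t by (intro bexI[of _ t]) (auto simp: lagrange_node)
next
  case False
  obtain L where L: "degree L \<le> r - 1" "\<And>t. lagrange r x f t = poly L t"
    using lagrange_eq_poly by blast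
  define W where "W = (\<Prod>s=1..r. [:- x s, 1:])"
  have W: "poly W t = (\<Prod>s=1..r. t - x s)" for t by (simp add: W_def poly_prod)
  have degW: "degree W = r" by (simp add: W_def degree_prod_eq_sum_degree)
  have "lead_coeff W = 1" unfolding W_def by (simp add: lead_coeff_prod)
  then have coeffW: "coeff W r = 1" by (simp add: degW)
  have W0: "poly W t \<noteq> 0" unfolding W using False by auto
  \<comment> \<open>The multiple of \<open>W\<close> that turns \<open>L\<close> into the interpolant at the nodes and at \<open>t\<close>.\<close>
  define c where "c = (f t - poly L t) / poly W t"
  define p where "p = L + smult c W"
  have "degree p \<le> r"
    unfolding p_def using L(1) r degW
    by (intro degree_add_le order_trans[OF degree_smult_le]) auto
  moreover have "card (insert t (x ` {1..r})) = Suc r"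
    using False x(1) by (simp add: card_image)
  moreover have "f y = poly p y" if "y \<in> insert t (x ` {1..r})" for y
  proof (cases "y = t")
    case True
    then show ?thesis using W0 by (simp add: p_def c_def)
  next
    case False
    then obtain k where k: "k \<in> {1..r}" "y = x k" using \<open>y \<in> _\<close> by auto
    have "poly W (x k) = 0" unfolding W using k(1) by (intro prod_zero) auto
    moreover have "poly L (x k) = f (x k)" using lagrange_node[OF x(1) k(1), of f] L(2) by simp
    ultimately show ?thesis by (simp add: p_def k(2))
  qed
  ultimately obtain \<xi> where \<xi>: "\<xi> \<in> {l..u}" "nderiv_on {a..b} r f \<xi> = fact r * coeff p r"
    using interpolation_mean_value[OF C lu, of p "insert t (x ` {1..r})"] t x(2) by auto
  have "coeff L r = 0" using L(1) r by (intro coeff_eq_0) auto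
  then have "coeff p r = c" by (simp add: p_def coeffW)
  then have "f t - lagrange r x f t = poly W t * (nderiv_on {a..b} r f \<xi> / fact r)"
    using \<xi>(2) W0 by (simp add: c_def L(2))
  then show ?thesis using \<xi>(1) unfolding W by blast
qed

section \<open>The partitions produced by bisection\<close>

definition tiling :: "real \<Rightarrow> real \<Rightarrow> ivl set \<Rightarrow> bool" where
  "tiling a b Q \<longleftrightarrow> finite Q \<and> (\<forall>I\<in>Q. a \<le> fst I \<and> fst I < snd I \<and> snd I \<le> b) \<and>
     (\<forall>I\<in>Q. \<forall>J\<in>Q. I \<noteq> J \<longrightarrow> snd I \<le> fst J \<or> snd J \<le> fst I) \<and>
     (\<Union>I\<in>Q. {fst I..snd I}) = {a..b}"

lemma tilingD:
  assumes "tiling a b Q"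
  shows "finite Q" "I \<in> Q \<Longrightarrow> a \<le> fst I" "I \<in> Q \<Longrightarrow> fst I < snd I" "I \<in> Q \<Longrightarrow> snd I \<le> b"
    "I \<in> Q \<Longrightarrow> J \<in> Q \<Longrightarrow> I \<noteq> J \<Longrightarrow> snd I \<le> fst J \<or> snd J \<le> fst I"
    "(\<Union>I\<in>Q. {fst I..snd I}) = {a..b}"
  using assms by (auto simp: tiling_def)

lemma partition_result_tiling:
  assumes "partition_result p a b m Q" "a < b"
  shows "tiling a b Q \<and> card Q = m"
  using assms
proof (induction rule: partition_result.induct)
  case start
  then show ?case by (auto simp: tiling_def)
next
  case (split m Q l u)
  then have tl: "tiling a b Q" and card: "card Q = m" by auto
  note t = tilingD[OF tl]
  have lu: "a \<le> l" "l < u" "u \<le> b" using t(2-4)[OF split.hyps(2)] by auto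
  have other: "snd I \<le> l \<or> u \<le> fst I" if "I \<in> Q - {(l, u)}" for I
    using t(5)[of I "(l, u)"] that split.hyps(2) by auto
  define c where "c = (l + u) / 2"
  have c: "l < c" "c < u" using lu by (auto simp: c_def)
  define R where "R = Q - {(l, u)}"
  have R: "I \<in> Q" "snd I \<le> l \<or> u \<le> fst I" "a \<le> fst I" "fst I < snd I" "snd I \<le> b" if "I \<in> R" for I
    using that t(2-4)[of I] other[of I] by (auto simp: R_def)
  have "(l, c) \<notin> R" "(c, u) \<notin> R" using R(2)[of "(l, c)"] R(2)[of "(c, u)"] c by auto
  moreover have "card R = m - 1" "m \<ge> 1" "finite R"
    using split.hyps(2) card t(1) by (auto simp: R_def card_gt_0_iff Suc_le_eq)
  ultimately have cardR: "card (R \<union> {(l, c), (c, u)}) = Suc m" using c by auto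
  have Q: "Q = insert (l, u) R" using split.hyps(2) by (auto simp: R_def)
  have "(\<Union>I\<in>R \<union> {(l, c), (c, u)}. {fst I..snd I}) = (\<Union>I\<in>R. {fst I..snd I}) \<union> ({l..c} \<union> {c..u})"
    by auto
  also have "{l..c} \<union> {c..u} = {l..u}" using c by auto
  also have "(\<Union>I\<in>R. {fst I..snd I}) \<union> {l..u} = {a..b}"
    unfolding t(6)[symmetric] Q by auto
  finally have un: "(\<Union>I\<in>R \<union> {(l, c), (c, u)}. {fst I..snd I}) = {a..b}" .
  have disj: "snd I \<le> fst J \<or> snd J \<le> fst I"
    if IJ: "I \<in> R \<union> {(l, c), (c, u)}" "J \<in> R \<union> {(l, c), (c, u)}" "I \<noteq> J" for I J
  proof -
    consider "I \<in> R" "J \<in> R" | "I \<in> R" "J = (l, c) \<or> J = (c, u)" | "J \<in> R" "I = (l, c) \<or> I = (c, u)"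
      | "I = (l, c)" "J = (c, u)" | "J = (l, c)" "I = (c, u)"
      using IJ by auto
    then show ?thesis
    proof cases
      case 1
      then show ?thesis using t(5)[of I J] R(1) IJ(3) by blast
    next
      case 2
      then show ?thesis using R(2)[of I] c by auto
    next
      case 3
      then show ?thesis using R(2)[of J] c by auto
    qed auto
  qed
  have "tiling a b (R \<union> {(l, c), (c, u)})"
    unfolding tiling_def
  proof (intro conjI ballI impI)
    show "a \<le> fst I" "fst I < snd I" "snd I \<le> b" if "I \<in> R \<union> {(l, c), (c, u)}" for I
      using that c lu R(3-5)[of I] by auto
  qed (use disj un \<open>finite R\<close> in auto)
  with cardR show ?case by (simp add: R_def c_def)
qed

lemma partition_result_halves:
  fixes a b l u :: real
  assumes "a \<le> l" "l < u" "u \<le> b" "I \<in> {(l, (l + u) / 2), ((l + u) / 2, u)}"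
  shows "len (l, u) = 2 * len I" "l \<le> fst I" "fst I < snd I" "snd I \<le> u"
  using assms by (auto simp: len_def field_simps)

text \<open>All integrals over \<open>[a, b]\<close> split into integrals over cells, because cells overlap in null sets only.\<close>

lemma tiling_has_integral:
  fixes F :: "real \<Rightarrow> real"
  assumes "tiling a b Q" "\<And>I. I \<in> Q \<Longrightarrow> (F has_integral c I) {fst I..snd I}"
  shows "(F has_integral (\<Sum>I\<in>Q. c I)) {a..b}"
proof -
  note t = tilingD[OF assms(1)]
  have "negligible ({fst I..snd I} \<inter> {fst J..snd J})" if "I \<in> Q" "J \<in> Q" "I \<noteq> J" for I J
  proof -
    have "{fst I..snd I} \<inter> {fst J..snd J} \<subseteq> {snd I, snd J}" using t(5)[OF that] by auto
    then show ?thesis by (rule negligible_subset[rotated]) simp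
  qed
  then show ?thesis
    unfolding t(6)[symmetric] using t(1) assms(2)
    by (intro has_integral_UN) (auto simp: pairwise_def)
qed

lemma sum_len_tiling:
  assumes "tiling a b Q" "a < b"
  shows "(\<Sum>I\<in>Q. len I) = b - a"
proof -
  have "((\<lambda>_. 1::real) has_integral (\<Sum>I\<in>Q. len I)) {a..b}"
  proof (rule tiling_has_integral[OF assms(1)])
    show "((\<lambda>_. 1::real) has_integral len I) {fst I..snd I}" if "I \<in> Q" for I
      using has_integral_const_real[of "1::real" "fst I" "snd I"] tilingD(3)[OF assms(1) that]
      by (simp add: len_def)
  qed
  moreover have "((\<lambda>_. 1::real) has_integral (b - a)) {a..b}"
    using has_integral_const_real[of "1::real" a b] assms(2) by simp
  ultimately show ?thesis by (rule has_integral_unique)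
qed

text \<open>
  Bisection balances priorities, and this already balances lengths: when a cell is halved,
  no other cell has a much higher priority, and a priority is comparable to the power
  \<open>r + 1\<close> of the length.
\<close>

lemma partition_result_quasi_uniform:
  fixes w :: "ivl \<Rightarrow> real"
  assumes "partition_result (\<lambda>I. len I ^ k * w I) a b m Q" "a < b"
    and c: "0 < c" "c \<le> C"
    and w: "\<And>I. a \<le> fst I \<Longrightarrow> fst I < snd I \<Longrightarrow> snd I \<le> b \<Longrightarrow> c \<le> w I \<and> w I \<le> C"
    and K: "2 \<le> K" "C / c * 2 ^ k \<le> K ^ k" and k: "k > 0"
    and "I \<in> Q" "J \<in> Q"
  shows "len I \<le> K * len J"
  using assms(1,2,9,10)
proof (induction arbitrary: I J rule: partition_result.induct)
  case start
  then show ?case using K(1) by (auto simp: len_def)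
next
  case (split m Q l u)
  note t = tilingD[OF conjunct1[OF partition_result_tiling[OF split.hyps(1) \<open>a < b\<close>]]]
  have lu: "a \<le> l" "l < u" "u \<le> b" using t(2-4)[OF split.hyps(2)] by auto
  let ?H = "{(l, (l + u) / 2), ((l + u) / 2, u)}"
  note half = partition_result_halves[OF lu]
  have IH: "len I \<le> K * len J" if "I \<in> Q" "J \<in> Q" for I J using split.IH that split.prems by blast
  consider "I \<in> Q" "J \<in> Q" | "I \<in> Q" "J \<in> ?H" | "I \<in> ?H" "J \<in> Q" | "I \<in> ?H" "J \<in> ?H"
    using split.prems by blast
  then show ?case
  proof cases
    case 1
    then show ?thesis using IH by blast
  next
    case 2
    have "len I > 0" "len (l, u) > 0" using t(3)[OF 2(1)] lu by (auto simp: len_def)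
    have "c * len I ^ k \<le> len I ^ k * w I"
      using w[OF t(2-4)[OF 2(1)]] \<open>len I > 0\<close> by (simp add: mult.commute)
    also have "\<dots> \<le> len (l, u) ^ k * w (l, u)" using split.hyps(3) 2(1) by blast
    also have "\<dots> \<le> len (l, u) ^ k * C"
      using w[of "(l, u)"] lu \<open>len (l, u) > 0\<close> by (intro mult_left_mono) auto
    also have "\<dots> = c * ((C / c * 2 ^ k) * len J ^ k)"
      unfolding half(1)[OF 2(2)] using c by (simp add: power_mult_distrib)
    also have "\<dots> \<le> c * (K ^ k * len J ^ k)"
      using K c half(3)[OF 2(2)] by (intro mult_left_mono mult_right_mono) (auto simp: len_def)
    finally have "len I ^ k \<le> (K * len J) ^ k" using c by (simp add: power_mult_distrib)
    then show ?thesis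
      using K half(3)[OF 2(2)] k \<open>len I > 0\<close>
      by (subst (asm) power_mono_iff) (auto simp: len_def)
  next
    case 3
    have "len I \<le> len (l, u)" using half(1)[OF 3(1)] half(3)[OF 3(1)] by (simp add: len_def)
    then show ?thesis using IH[OF split.hyps(2) 3(2)] by simp
  next
    case 4
    have "len I = len J" "len J > 0" using half(1)[OF 4(1)] half(1)[OF 4(2)] half(3)[OF 4(2)] by (auto simp: len_def)
    then show ?thesis using K(1) by simp
  qed
qed

text \<open>
  Once cells are short, halving divides a priority by nearly \<open>2 ^ k\<close>; the maximal priority no longer
  grows, and no cell falls below it by more than the factor lost when it was created. Whether cells are
  short is read off the single cell \<open>J\<close>: by \<open>uniform\<close> all cells are then short, also
  at the earlier time when \<open>J\<close> was created, so the claim is an invariant of the procedure from its first step on.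
\<close>

lemma partition_result_priorities:
  fixes w :: "ivl \<Rightarrow> real"
  assumes "partition_result (\<lambda>I. len I ^ k * w I) a b m Q" "a < b"
    and uniform: "\<And>m Q I J. partition_result (\<lambda>I. len I ^ k * w I) a b m Q \<Longrightarrow>
      I \<in> Q \<Longrightarrow> J \<in> Q \<Longrightarrow> len I \<le> K * len J"
    and w: "\<And>I. a \<le> fst I \<Longrightarrow> fst I < snd I \<Longrightarrow> snd I \<le> b \<Longrightarrow> 0 \<le> w I"
    and close: "\<And>I J. a \<le> fst J \<Longrightarrow> fst J \<le> fst I \<Longrightarrow> fst I < snd I \<Longrightarrow> snd I \<le> snd J \<Longrightarrow> snd J \<le> b \<Longrightarrow>
      len J \<le> \<delta> \<Longrightarrow> w I \<le> (1 + \<epsilon>) * w J \<and> w J \<le> (1 + \<epsilon>) * w I"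
    and K: "2 \<le> K" and k: "k > 0" and \<epsilon>: "0 \<le> \<epsilon>" "\<epsilon> \<le> 1"
    and IJ: "I \<in> Q" "J \<in> Q" "K * len J \<le> \<delta>"
  shows "len I ^ k * w I \<le> 2 ^ k * (1 + \<epsilon>) * (len J ^ k * w J)"
  using assms(1,2) IJ
proof (induction arbitrary: I J rule: partition_result.induct)
  case start
  have "1 * 1 \<le> 2 ^ k * (1 + \<epsilon>)" using \<epsilon>(1) by (intro mult_mono one_le_power) auto
  then have "1 * (len (a, b) ^ k * w (a, b)) \<le> 2 ^ k * (1 + \<epsilon>) * (len (a, b) ^ k * w (a, b))"
    using start w[of "(a, b)"] by (intro mult_right_mono) (auto simp: len_def)
  then show ?case using start by simp
next
  case (split m Q l u)
  let ?p = "\<lambda>I. len I ^ k * w I"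
  note t = tilingD[OF conjunct1[OF partition_result_tiling[OF split.hyps(1) \<open>a < b\<close>]]]
  have lu: "a \<le> l" "l < u" "u \<le> b" using t(2-4)[OF split.hyps(2)] by auto
  let ?H = "{(l, (l + u) / 2), ((l + u) / 2, u)}"
  note half = partition_result_halves[OF lu]
  have IH: "?p I \<le> 2 ^ k * (1 + \<epsilon>) * ?p J" if "I \<in> Q" "J \<in> Q" "K * len J \<le> \<delta>" for I J
    using split.IH that split.prems by blast
  have w0: "0 \<le> w (l, u)" using w[of "(l, u)"] lu by simp
  have "(1 + \<epsilon>) \<le> 2 ^ 1" using \<epsilon> by simp
  also have "\<dots> \<le> (2::real) ^ k" using k by (intro power_increasing) auto
  finally have \<epsilon>k: "1 + \<epsilon> \<le> 2 ^ k" .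
  have child: "?p H \<le> ?p (l, u)" "?p (l, u) \<le> 2 ^ k * (1 + \<epsilon>) * ?p H"
    if H: "H \<in> ?H" and small: "len (l, u) \<le> \<delta>" for H
  proof -
    have len: "len H > 0" using half(3)[OF H] by (simp add: len_def)
    have wH: "w H \<le> (1 + \<epsilon>) * w (l, u)" "w (l, u) \<le> (1 + \<epsilon>) * w H"
      using close[of "(l, u)" H] lu half(2-4)[OF H] small by auto
    have "?p H \<le> len H ^ k * ((1 + \<epsilon>) * w (l, u))"
      using len wH(1) by (intro mult_left_mono) auto
    also have "\<dots> \<le> len H ^ k * (2 ^ k * w (l, u))"
      using len w0 \<epsilon>k by (intro mult_left_mono mult_right_mono) auto
    finally show "?p H \<le> ?p (l, u)" by (simp add: half(1)[OF H] power_mult_distrib ac_simps)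
    have "?p (l, u) = 2 ^ k * len H ^ k * w (l, u)" by (simp add: half(1)[OF H] power_mult_distrib)
    also have "\<dots> \<le> 2 ^ k * len H ^ k * ((1 + \<epsilon>) * w H)"
      using len wH(2) by (intro mult_left_mono) auto
    finally show "?p (l, u) \<le> 2 ^ k * (1 + \<epsilon>) * ?p H" by (simp add: algebra_simps)
  qed
  have small: "len (l, u) \<le> \<delta>" if "J \<in> ?H"
  proof -
    have "len (l, u) = 2 * len J" using half(1)[OF that] .
    also have "\<dots> \<le> K * len J" using K half(3)[OF that] by (intro mult_right_mono) (auto simp: len_def)
    finally show ?thesis using split.prems by simp
  qed
  have small': "len (l, u) \<le> \<delta>" if "J \<in> Q"
    using uniform[OF split.hyps(1) split.hyps(2) that] split.prems by linarith
  consider "I \<in> Q" "J \<in> Q" | "I \<in> Q" "J \<in> ?H" | "I \<in> ?H" "J \<in> Q" | "I \<in> ?H" "J \<in> ?H"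
    using split.prems by blast
  then show ?case
  proof cases
    case 1
    then show ?thesis using IH split.prems by blast
  next
    case 2
    have "?p I \<le> ?p (l, u)" using split.hyps(3) 2(1) by blast
    then show ?thesis using child(2)[OF 2(2) small[OF 2(2)]] by linarith
  next
    case 3
    then show ?thesis
      using child(1)[OF 3(1) small'[OF 3(2)]] IH[OF split.hyps(2) 3(2)] split.prems by linarith
  next
    case 4
    then show ?thesis
      using child(1)[OF 4(1) small[OF 4(2)]] child(2)[OF 4(2) small[OF 4(2)]] by linarith
  qed
qed

text \<open>
  The priorities satisfy the ratio bound \<open>2 ^ k\<close> only up to a factor close to one. Truncating
  them at \<open>2 ^ k\<close> times their minimum yields numbers that satisfy it exactly, at the cost of the same
  factor in the approximation of \<open>g\<close>.
\<close>

lemma partition_result_balanced: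
  fixes g :: "real \<Rightarrow> real" and w :: "ivl \<Rightarrow> real"
  assumes ab: "a < b" and k: "k > 0" and \<epsilon>: "0 < \<epsilon>" "\<epsilon> \<le> 1"
    and cont: "continuous_on {a..b} g" and pos: "\<And>x. x \<in> {a..b} \<Longrightarrow> g x > 0"
    and w: "\<And>I. a \<le> fst I \<Longrightarrow> fst I < snd I \<Longrightarrow> snd I \<le> b \<Longrightarrow> \<exists>\<xi>\<in>{fst I..snd I}. w I = g \<xi>"
  shows "\<exists>m0. \<forall>m\<ge>m0. \<forall>Q. partition_result (\<lambda>I. len I ^ k * w I) a b m Q \<longrightarrow>
    (\<exists>v. (\<forall>I\<in>Q. v I > 0) \<and> (\<forall>I\<in>Q. \<forall>J\<in>Q. len I ^ k * v I \<le> 2 ^ k * (len J ^ k * v J)) \<and>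
      (\<forall>I\<in>Q. \<forall>x\<in>{fst I..snd I}. \<bar>g x - v I\<bar> \<le> \<epsilon> * v I))"
proof -
  \<comment> \<open>\<open>g\<close> differs from the priority weight by a factor \<open>1 + \<eta>\<close>, and the weight from its truncation by another one.\<close>
  define \<eta> where "\<eta> = \<epsilon> / 3"
  have \<eta>: "0 < \<eta>" "\<eta> \<le> 1" "\<eta> \<le> \<epsilon>" using \<epsilon> by (auto simp: \<eta>_def)
  have "\<epsilon> * \<epsilon> \<le> \<epsilon> * 1" using \<epsilon> by (intro mult_left_mono) auto
  moreover have "(1 + \<eta>) * (1 + \<eta>) = 1 + 2 / 3 * \<epsilon> + \<epsilon> * \<epsilon> / 9" by (simp add: \<eta>_def algebra_simps)
  ultimately have \<eta>2: "(1 + \<eta>) * (1 + \<eta>) \<le> 1 + \<epsilon>" using \<epsilon>(1) by linarith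
  obtain x0 where x0: "x0 \<in> {a..b}" "\<And>x. x \<in> {a..b} \<Longrightarrow> g x0 \<le> g x"
    using continuous_attains_inf[OF _ _ cont] ab by auto
  obtain x1 where x1: "x1 \<in> {a..b}" "\<And>x. x \<in> {a..b} \<Longrightarrow> g x \<le> g x1"
    using continuous_attains_sup[OF _ _ cont] ab by auto
  define c C where "c = g x0" and "C = g x1"
  have c: "0 < c" "c \<le> C" using pos[OF x0(1)] x0 x1 by (auto simp: c_def C_def)
  have wcC: "c \<le> w I \<and> w I \<le> C" if I: "a \<le> fst I" "fst I < snd I" "snd I \<le> b" for I
  proof -
    obtain \<xi> where "\<xi> \<in> {fst I..snd I}" "w I = g \<xi>" using w[OF I] by blast
    then show ?thesis using x0(2)[of \<xi>] x1(2)[of \<xi>] I by (auto simp: c_def C_def)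
  qed
  \<comment> \<open>A factor such that lengths in one partition differ at most by it.\<close>
  define K where "K = 2 * (C / c)"
  have "1 \<le> C / c" using c by simp
  then have K: "2 \<le> K" by (simp add: K_def)
  have "(C / c) ^ 1 \<le> (C / c) ^ k" using \<open>1 \<le> C / c\<close> k by (intro power_increasing) auto
  then have "C / c * 2 ^ k \<le> (C / c) ^ k * 2 ^ k" by (intro mult_right_mono) auto
  also have "\<dots> = K ^ k" by (simp only: K_def power_mult_distrib mult.commute)
  finally have Kk: "C / c * 2 ^ k \<le> K ^ k" .
  let ?p = "\<lambda>I. len I ^ k * w I"
  have uniform: "len I \<le> K * len J" if "partition_result ?p a b m Q" "I \<in> Q" "J \<in> Q" for m Q I J
    using partition_result_quasi_uniform[OF that(1) ab c wcC K Kk k that(2,3)] .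
  obtain \<delta> where \<delta>: "\<delta> > 0" and unif: "\<And>x y. x \<in> {a..b} \<Longrightarrow> y \<in> {a..b} \<Longrightarrow> \<bar>y - x\<bar> < \<delta> \<Longrightarrow> \<bar>g y - g x\<bar> < \<eta> * c"
    using compact_uniformly_continuous[OF cont] \<eta>(1) c(1)
    unfolding uniformly_continuous_on_def dist_real_def by (metis compact_Icc mult_pos_pos)
  have near: "g y \<le> (1 + \<eta>) * g x" if "x \<in> {l..u}" "y \<in> {l..u}" "a \<le> l" "u \<le> b" "u - l \<le> \<delta> / 2" for x y l u
  proof -
    have "\<bar>g y - g x\<bar> < \<eta> * c" using that \<delta> by (intro unif) auto
    moreover have "\<eta> * c \<le> \<eta> * g x" using x0(2)[of x] that \<eta> by (auto simp: c_def)
    ultimately show ?thesis by (simp add: algebra_simps)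
  qed
  have close: "w I \<le> (1 + \<eta>) * w J \<and> w J \<le> (1 + \<eta>) * w I"
    if h: "a \<le> fst J" "fst J \<le> fst I" "fst I < snd I" "snd I \<le> snd J" "snd J \<le> b" "len J \<le> \<delta> / 2" for I J
  proof -
    obtain \<xi> where 1: "\<xi> \<in> {fst I..snd I}" "w I = g \<xi>" using w[of I] h by auto
    obtain \<zeta> where 2: "\<zeta> \<in> {fst J..snd J}" "w J = g \<zeta>" using w[of J] h by auto
    have "\<xi> \<in> {fst J..snd J}" using 1 h by auto
    then show ?thesis using near[of \<xi> "fst J" "snd J" \<zeta>] near[of \<zeta> "fst J" "snd J" \<xi>] 1 2 h by (auto simp: len_def)
  qed
  \<comment> \<open>The average length is \<open>(b - a) / m\<close>, so \<open>K\<close> times this bounds all lengths; the second factor \<open>K\<close> is the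
    one in the smallness condition of the lemma on priorities.\<close>
  define m0 where "m0 = nat \<lceil>K * K * (b - a) / (\<delta> / 2)\<rceil>"
  show ?thesis
  proof (intro exI[of _ m0] allI impI)
    fix m Q assume m: "m \<ge> m0" and Q: "partition_result ?p a b m Q"
    have tl: "tiling a b Q" and card: "card Q = m" using partition_result_tiling[OF Q ab] by auto
    note t = tilingD[OF tl]
    have Qne: "Q \<noteq> {}" using sum_len_tiling[OF tl ab] ab by auto
    then have m_pos: "m > 0" using t(1) card by (auto simp: card_gt_0_iff)
    have len: "len I > 0" if "I \<in> Q" for I using t(3)[OF that] by (simp add: len_def)
    have small: "K * len I \<le> \<delta> / 2" if I: "I \<in> Q" for I
    proof -
      have "real m * len I = (\<Sum>J\<in>Q. len I)" by (simp add: card)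
      also have "\<dots> \<le> (\<Sum>J\<in>Q. K * len J)" using uniform[OF Q I] by (intro sum_mono)
      also have "\<dots> = K * (b - a)" by (simp add: sum_distrib_left[symmetric] sum_len_tiling[OF tl ab])
      finally have "K * (real m * len I) \<le> K * (K * (b - a))" using K by (intro mult_left_mono) auto
      moreover have "K * K * (b - a) / (\<delta> / 2) \<le> real m" using m unfolding m0_def by linarith
      then have "K * K * (b - a) \<le> real m * (\<delta> / 2)" using \<delta> by (simp add: field_simps)
      ultimately have "real m * (K * len I) \<le> real m * (\<delta> / 2)" by (simp add: algebra_simps)
      then show ?thesis using m_pos by simp
    qed
    have w_pos: "w I > 0" if "I \<in> Q" for I using wcC[OF t(2-4)[OF that]] c by simp
    have ratio: "?p I \<le> 2 ^ k * (1 + \<eta>) * ?p J" if "I \<in> Q" "J \<in> Q" for I J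
      using \<eta> wcC c
      by (intro partition_result_priorities[OF Q ab uniform _ close K k _ _ that(1,2) small[OF that(2)]]) force+
    define \<mu> where "\<mu> = Min (?p ` Q)"
    have \<mu>: "\<mu> \<le> ?p I" if "I \<in> Q" for I using that t(1) by (simp add: \<mu>_def)
    have "\<mu> \<in> ?p ` Q" using t(1) Qne by (simp add: \<mu>_def)
    then obtain I0 where I0: "I0 \<in> Q" "\<mu> = ?p I0" by auto
    have \<mu>_pos: "\<mu> > 0" using I0 len w_pos by simp
    define v where "v I = min (?p I) (2 ^ k * \<mu>) / len I ^ k" for I
    have A: "len I ^ k * v I = min (?p I) (2 ^ k * \<mu>)" if "I \<in> Q" for I
      using len[OF that] by (simp add: v_def)
    have v_pos: "v I > 0" if "I \<in> Q" for I
      using len[OF that] w_pos[OF that] \<mu>_pos by (simp add: v_def)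
    have "v I \<le> ?p I / len I ^ k" if "I \<in> Q" for I
      unfolding v_def using len[OF that] by (intro divide_right_mono) auto
    then have v_le: "v I \<le> w I" if "I \<in> Q" for I using len[OF that] that by fastforce
    have w_le: "w I \<le> (1 + \<eta>) * v I" if "I \<in> Q" for I
    proof -
      have "?p I \<le> (1 + \<eta>) * min (?p I) (2 ^ k * \<mu>)"
        using ratio[OF that I0(1)] \<eta>(1) len[OF that] w_pos[OF that] I0(2)
        by (auto simp: min_def algebra_simps)
      also have "\<dots> = (1 + \<eta>) * (len I ^ k * v I)" using A[OF that] by simp
      finally have "len I ^ k * w I \<le> len I ^ k * ((1 + \<eta>) * v I)" by (simp add: algebra_simps)
      then show ?thesis using len[OF that] by simp
    qed
    have "len I ^ k * v I \<le> 2 ^ k * (len J ^ k * v J)" if "I \<in> Q" "J \<in> Q" for I J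
    proof -
      have "\<mu> \<le> min (?p J) (2 ^ k * \<mu>)" using \<mu>[OF that(2)] \<mu>_pos by simp
      then have "2 ^ k * \<mu> \<le> 2 ^ k * min (?p J) (2 ^ k * \<mu>)" by simp
      then show ?thesis unfolding A[OF that(1)] A[OF that(2)] by linarith
    qed
    moreover have "\<bar>g x - v I\<bar> \<le> \<epsilon> * v I" if I: "I \<in> Q" and x: "x \<in> {fst I..snd I}" for I x
    proof -
      obtain \<xi> where \<xi>: "\<xi> \<in> {fst I..snd I}" "w I = g \<xi>" using w[OF t(2-4)[OF I]] by auto
      have "1 * len I \<le> K * len I" using K len[OF I] by (intro mult_right_mono) auto
      then have *: "snd I - fst I \<le> \<delta> / 2" using small[OF I] by (simp add: len_def)
      have "g x \<le> (1 + \<eta>) * w I" unfolding \<xi>(2) using \<xi>(1) x t(2,4)[OF I] * by (intro near)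
      also have "\<dots> \<le> (1 + \<eta>) * ((1 + \<eta>) * v I)" using w_le[OF I] \<eta> by (intro mult_left_mono) auto
      also have "\<dots> = ((1 + \<eta>) * (1 + \<eta>)) * v I" by simp
      also have "\<dots> \<le> (1 + \<epsilon>) * v I" using v_pos[OF I] \<eta>2 by (intro mult_right_mono) auto
      finally have up: "g x \<le> (1 + \<epsilon>) * v I" .
      have "v I \<le> (1 + \<eta>) * g x"
        using near[OF x \<xi>(1) t(2,4)[OF I] *] v_le[OF I] \<xi>(2) by simp
      then have "(1 - \<eta>) * v I \<le> (1 - \<eta>) * ((1 + \<eta>) * g x)" using \<eta> by (intro mult_left_mono) auto
      also have "\<dots> = (1 - \<eta> * \<eta>) * g x" by (simp add: algebra_simps)
      also have "\<dots> \<le> 1 * g x" using pos[of x] x t(2,4)[OF I] by (intro mult_right_mono) auto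
      finally have "v I - \<eta> * v I \<le> g x" by (simp add: algebra_simps)
      moreover have "\<eta> * v I \<le> \<epsilon> * v I" using \<eta> v_pos[OF I] by (intro mult_right_mono) auto
      ultimately show ?thesis using up by (simp add: algebra_simps abs_le_iff)
    qed
    ultimately show "\<exists>v. (\<forall>I\<in>Q. v I > 0) \<and>
        (\<forall>I\<in>Q. \<forall>J\<in>Q. len I ^ k * v I \<le> 2 ^ k * (len J ^ k * v J)) \<and>
        (\<forall>I\<in>Q. \<forall>x\<in>{fst I..snd I}. \<bar>g x - v I\<bar> \<le> \<epsilon> * v I)"
      using v_pos by (intro exI[of _ v]) blast
  qed
qed

section \<open>The mean square error of the algorithm\<close>

text \<open>
  The classical Monte Carlo variance with importance sampling density \<open>\<rho>\<close>: the centred summands are pairwise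
  uncorrelated, so only the diagonal of the expanded square survives.
\<close>

lemma (in prob_space) expectation_square_sample_mean:
  fixes W \<rho> :: "real \<Rightarrow> real" and T :: "nat \<Rightarrow> 'a \<Rightarrow> real"
  assumes indep: "indep_vars (\<lambda>_. borel) T {1..n}" and n: "n \<ge> 1"
    and density: "\<And>l. l \<in> {1..n} \<Longrightarrow> distributed M lborel (T l) (\<lambda>x. ennreal (\<rho> x))"
    and \<rho>: "\<And>x. 0 \<le> \<rho> x"
    and W: "W \<in> borel_measurable borel"
    and int1: "integrable lborel (\<lambda>x. \<rho> x * W x)"
    and int2: "integrable lborel (\<lambda>x. \<rho> x * (W x)\<^sup>2)"
    and \<mu>: "\<mu> = (\<integral>x. \<rho> x * W x \<partial>lborel)"
  shows "integrable M (\<lambda>\<omega>. (\<mu> - 1 / real n * (\<Sum>l=1..n. W (T l \<omega>)))\<^sup>2)"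
    and "expectation (\<lambda>\<omega>. (\<mu> - 1 / real n * (\<Sum>l=1..n. W (T l \<omega>)))\<^sup>2) =
      ((\<integral>x. \<rho> x * (W x)\<^sup>2 \<partial>lborel) - \<mu>\<^sup>2) / real n"
proof -
  define X where "X l \<omega> = W (T l \<omega>) - \<mu>" for l \<omega>
  have indepX: "indep_vars (\<lambda>_. borel) X {1..n}"
    unfolding X_def using W by (intro indep_vars_compose2[OF indep, of "\<lambda>_ x. W x - \<mu>"]) simp
  have intW: "integrable M (\<lambda>\<omega>. W (T l \<omega>))" and intW2: "integrable M (\<lambda>\<omega>. (W (T l \<omega>))\<^sup>2)"
    and expW: "expectation (\<lambda>\<omega>. W (T l \<omega>)) = \<mu>"
    and expW2: "expectation (\<lambda>\<omega>. (W (T l \<omega>))\<^sup>2) = (\<integral>x. \<rho> x * (W x)\<^sup>2 \<partial>lborel)" if "l \<in> {1..n}" for l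
    using distributed_integrable[OF density[OF that], of W] distributed_integrable[OF density[OF that], of "\<lambda>x. (W x)\<^sup>2"]
      distributed_integral[OF density[OF that], of W] distributed_integral[OF density[OF that], of "\<lambda>x. (W x)\<^sup>2"]
      W \<rho> int1 int2 \<mu> by auto
  have sq: "(X l \<omega>)\<^sup>2 = (W (T l \<omega>))\<^sup>2 - 2 * \<mu> * W (T l \<omega>) + \<mu>\<^sup>2" for l \<omega>
    by (simp add: X_def power2_eq_square algebra_simps)
  have intX: "integrable M (X l)" and expX: "expectation (X l) = 0" if "l \<in> {1..n}" for l
    unfolding X_def using intW[OF that] expW[OF that] by (auto simp: prob_space)
  have intX2: "integrable M (\<lambda>\<omega>. (X l \<omega>)\<^sup>2)"
    and expX2: "expectation (\<lambda>\<omega>. (X l \<omega>)\<^sup>2) = (\<integral>x. \<rho> x * (W x)\<^sup>2 \<partial>lborel) - \<mu>\<^sup>2" if "l \<in> {1..n}" for l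
  proof -
    show "integrable M (\<lambda>\<omega>. (X l \<omega>)\<^sup>2)" unfolding sq using intW[OF that] intW2[OF that] by auto
    have "expectation (\<lambda>\<omega>. (X l \<omega>)\<^sup>2) = expectation (\<lambda>\<omega>. (W (T l \<omega>))\<^sup>2) - 2 * \<mu> * expectation (\<lambda>\<omega>. W (T l \<omega>)) + \<mu>\<^sup>2"
      unfolding sq using intW[OF that] intW2[OF that] by (simp add: prob_space)
    then show "expectation (\<lambda>\<omega>. (X l \<omega>)\<^sup>2) = (\<integral>x. \<rho> x * (W x)\<^sup>2 \<partial>lborel) - \<mu>\<^sup>2"
      using expW[OF that] expW2[OF that] by (simp add: power2_eq_square)
  qed
  have mix: "integrable M (\<lambda>\<omega>. X i \<omega> * X j \<omega>) \<and> expectation (\<lambda>\<omega>. X i \<omega> * X j \<omega>) = (if i = j then (\<integral>x. \<rho> x * (W x)\<^sup>2 \<partial>lborel) - \<mu>\<^sup>2 else 0)"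
    if "i \<in> {1..n}" "j \<in> {1..n}" for i j
  proof (cases "i = j")
    case True
    then show ?thesis using intX2[OF that(1)] expX2[OF that(1)] by (simp add: power2_eq_square)
  next
    case False
    have ind: "indep_vars (\<lambda>_. borel) X {i, j}" using that by (intro indep_vars_subset[OF indepX]) auto
    have "integrable M (X k)" if "k \<in> {i, j}" for k using that intX \<open>i \<in> _\<close> \<open>j \<in> _\<close> by auto
    from indep_vars_integrable[OF _ ind this] indep_vars_lebesgue_integral[OF _ ind this]
    show ?thesis using False expX[OF that(1)] by simp
  qed
  have eq: "(\<mu> - 1 / real n * (\<Sum>l=1..n. W (T l \<omega>)))\<^sup>2 = (1 / real n)\<^sup>2 * (\<Sum>i=1..n. \<Sum>j=1..n. X i \<omega> * X j \<omega>)" for \<omega>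
  proof -
    have "\<mu> - 1 / real n * (\<Sum>l=1..n. W (T l \<omega>)) = - (1 / real n * (\<Sum>l=1..n. X l \<omega>))"
      using n by (simp add: X_def sum_subtractf field_simps)
    then show ?thesis
      by (simp only: power2_minus power_mult_distrib) (simp add: power2_eq_square sum_product)
  qed
  show "integrable M (\<lambda>\<omega>. (\<mu> - 1 / real n * (\<Sum>l=1..n. W (T l \<omega>)))\<^sup>2)"
    unfolding eq using mix by (intro integrable_mult_right Bochner_Integration.integrable_sum) auto
  have "expectation (\<lambda>\<omega>. (\<mu> - 1 / real n * (\<Sum>l=1..n. W (T l \<omega>)))\<^sup>2)
      = (1 / real n)\<^sup>2 * (\<Sum>i=1..n. \<Sum>j=1..n. expectation (\<lambda>\<omega>. X i \<omega> * X j \<omega>))"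
    unfolding eq using mix
    by (subst integral_mult_right_zero, subst Bochner_Integration.integral_sum, force)
       (intro arg_cong2[of _ _ _ _ "(*)"] sum.cong refl Bochner_Integration.integral_sum, force)
  also have "\<dots> = (1 / real n)\<^sup>2 * (\<Sum>i=1..n. \<Sum>j=1..n. if i = j then (\<integral>x. \<rho> x * (W x)\<^sup>2 \<partial>lborel) - \<mu>\<^sup>2 else 0)"
    using mix by (intro arg_cong2[of _ _ _ _ "(*)"] sum.cong refl) auto
  also have "\<dots> = ((\<integral>x. \<rho> x * (W x)\<^sup>2 \<partial>lborel) - \<mu>\<^sup>2) / real n"
    using n by (simp add: power2_eq_square)
  finally show "expectation (\<lambda>\<omega>. (\<mu> - 1 / real n * (\<Sum>l=1..n. W (T l \<omega>)))\<^sup>2) =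
      ((\<integral>x. \<rho> x * (W x)\<^sup>2 \<partial>lborel) - \<mu>\<^sup>2) / real n" .
qed

lemma cell_eq:
  assumes "tiling a b Q" "I \<in> Q" "fst I < x" "x < snd I"
  shows "cell Q x = I"
  unfolding cell_def
proof (rule some_equality)
  show "I \<in> Q \<and> x \<in> {fst I..snd I}" using assms by auto
next
  fix J assume "J \<in> Q \<and> x \<in> {fst J..snd J}"
  then show "J = I" using tilingD(5)[OF assms(1,2), of J] assms(3,4) by auto
qed

lemma cell_in:
  assumes "tiling a b Q" "x \<in> {a..b}"
  shows "cell Q x \<in> Q"
proof -
  have "\<exists>I. I \<in> Q \<and> x \<in> {fst I..snd I}" using assms tilingD(6)[OF assms(1)] by blast
  then show ?thesis unfolding cell_def by (rule someI2_ex) blast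
qed

lemma has_bochner_integral_Ioo:
  fixes h :: "real \<Rightarrow> real"
  assumes "continuous_on {l..u} h"
  shows "has_bochner_integral lborel (\<lambda>x. indicator {l<..<u} x * h x) (integral {l..u} h)"
proof -
  have "set_integrable lborel {l<..<u} h"
    by (rule set_integrable_subset[OF borel_integrable_atLeastAtMost'[OF assms]]) auto
  from this set_borel_integral_eq_integral(2)[OF this] show ?thesis
    unfolding set_integrable_def set_lebesgue_integral_def
    by (simp add: has_bochner_integral_iff integral_open_interval_real)
qed

text \<open>
  Piecewise functions built on the open cells, and zero at the breakpoints and outside \<open>[a, b]\<close>. Unlike the functions
  defined through \<^const>\<open>cell\<close>, they are measurable sums of pieces, and they agree with those almost everywhere on \<open>[a, b]\<close>.
\<close>

definition cellwise :: "ivl set \<Rightarrow> (ivl \<Rightarrow> real \<Rightarrow> real) \<Rightarrow> real \<Rightarrow> real" where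
  "cellwise Q h x = (\<Sum>I\<in>Q. indicator {fst I<..<snd I} x * h I x)"

lemma cellwise_eq:
  assumes "tiling a b Q" "I \<in> Q" "fst I < x" "x < snd I"
  shows "cellwise Q h x = h I x"
proof -
  have "indicator {fst J<..<snd J} x * h J x = (if J = I then h I x else 0)" if "J \<in> Q" for J
    using tilingD(5)[OF assms(1,2) that] assms(3,4) by (auto simp: indicator_def)
  then have "cellwise Q h x = (\<Sum>J\<in>Q. if J = I then h I x else 0)"
    unfolding cellwise_def by (intro sum.cong) auto
  then show ?thesis using tilingD(1)[OF assms(1)] assms(2) by simp
qed

lemma cellwise_eq_0: "(\<And>I. I \<in> Q \<Longrightarrow> \<not> (fst I < x \<and> x < snd I)) \<Longrightarrow> cellwise Q h x = 0"
  unfolding cellwise_def by (intro sum.neutral) (auto simp: indicator_def)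

lemma has_bochner_integral_cellwise:
  assumes "\<And>I. I \<in> Q \<Longrightarrow> continuous_on {fst I..snd I} (h I)"
  shows "has_bochner_integral lborel (cellwise Q h) (\<Sum>I\<in>Q. integral {fst I..snd I} (h I))"
  unfolding cellwise_def using assms
  by (intro has_bochner_integral_sum has_bochner_integral_Ioo)

text \<open>
  The random quadrature error is the deviation of a sample mean from its expectation. Since \<open>f\<close> is
  arbitrary outside \<open>[a, b]\<close>, the integrand on the left need not be measurable; in that case its expectation is
  zero by convention, and the bound still holds.
\<close>

lemma mean_square_error_le:
  fixes M :: "'w measure" and T :: "nat \<Rightarrow> 'w \<Rightarrow> real"
  assumes ab: "a < b" and tl: "tiling a b Q" and m: "m \<ge> 1" and n: "n \<ge> 1"
    and prob: "prob_space M"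
    and indep: "prob_space.indep_vars M (\<lambda>_. borel) T {1..n}"
    and density: "\<And>l. l \<in> {1..n} \<Longrightarrow> distributed M lborel (T l) (\<lambda>x. ennreal (rho a b m Q x))"
    and f: "continuous_on {a..b} f"
    and e: "e = (\<lambda>I x. f x - lagrange r (\<lambda>s. fst I + z s * len I) f x)"
  shows "prob_space.expectation M (\<lambda>\<omega>. (integral {a..b} f - M_alg r z a b m n Q f (\<lambda>l. T l \<omega>))\<^sup>2)
    \<le> (real m * (\<Sum>I\<in>Q. len I * integral {fst I..snd I} (\<lambda>x. (e I x)\<^sup>2))
        - (\<Sum>I\<in>Q. integral {fst I..snd I} (e I))\<^sup>2) / real n"
proof -
  interpret prob_space M by (rule prob)
  note t = tilingD[OF tl]
  let ?\<rho> = "rho a b m Q"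
  let ?L = "\<lambda>I x. lagrange r (\<lambda>s. fst I + z s * len I) f x"
  have len: "len I > 0" if "I \<in> Q" for I using t(3)[OF that] by (simp add: len_def)
  have cont_L: "continuous_on S (?L I)" for S I
  proof -
    obtain p where "?L I = poly p" using lagrange_eq_poly[of r "\<lambda>s. fst I + z s * len I" f] by blast
    then show ?thesis by (simp add: continuous_on_poly)
  qed
  have cont_f: "continuous_on {fst I..snd I} f" if "I \<in> Q" for I
    using t(2,4)[OF that] by (intro continuous_on_subset[OF f]) auto
  have cont_e: "continuous_on {fst I..snd I} (e I)" if "I \<in> Q" for I
    unfolding e using cont_f[OF that] cont_L by (intro continuous_intros)
  have \<rho>_nonneg: "0 \<le> ?\<rho> x" for x
    using len[OF cell_in[OF tl, of x]] by (auto simp: rho_def zero_le_mult_iff)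
  define W where "W = cellwise Q (\<lambda>I x. real m * len I * e I x)"
  have \<rho>W: "?\<rho> x * W x = cellwise Q e x"
    and \<rho>W2: "?\<rho> x * (W x)\<^sup>2 = cellwise Q (\<lambda>I x. real m * len I * (e I x)\<^sup>2) x" for x
  proof -
    have "?\<rho> x * W x = cellwise Q e x \<and> ?\<rho> x * (W x)\<^sup>2 = cellwise Q (\<lambda>I x. real m * len I * (e I x)\<^sup>2) x"
    proof (cases "\<exists>I\<in>Q. fst I < x \<and> x < snd I")
      case True
      then obtain I where I: "I \<in> Q" "fst I < x" "x < snd I" by blast
      have "x \<in> {a..b}" using I t(2,4)[OF I(1)] by auto
      then show ?thesis
        using len[OF I(1)] m
        by (simp add: W_def cellwise_eq[OF tl I] rho_def cell_eq[OF tl I] power2_eq_square)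
    next
      case False
      then show ?thesis by (simp add: W_def cellwise_eq_0)
    qed
    then show "?\<rho> x * W x = cellwise Q e x" "?\<rho> x * (W x)\<^sup>2 = cellwise Q (\<lambda>I x. real m * len I * (e I x)\<^sup>2) x" by auto
  qed
  have int_W: "has_bochner_integral lborel W (\<Sum>I\<in>Q. integral {fst I..snd I} (\<lambda>x. real m * len I * e I x))"
    unfolding W_def by (intro has_bochner_integral_cellwise continuous_intros cont_e)
  then have W_meas: "W \<in> borel_measurable borel" by (auto simp: has_bochner_integral_iff)
  define \<mu> where "\<mu> = (\<Sum>I\<in>Q. integral {fst I..snd I} (e I))"
  have int1: "has_bochner_integral lborel (\<lambda>x. ?\<rho> x * W x) \<mu>"
    unfolding \<rho>W \<mu>_def by (intro has_bochner_integral_cellwise cont_e)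
  have "has_bochner_integral lborel (\<lambda>x. ?\<rho> x * (W x)\<^sup>2)
      (\<Sum>I\<in>Q. integral {fst I..snd I} (\<lambda>x. real m * len I * (e I x)\<^sup>2))"
    unfolding \<rho>W2 by (intro has_bochner_integral_cellwise continuous_intros cont_e)
  also have "(\<Sum>I\<in>Q. integral {fst I..snd I} (\<lambda>x. real m * len I * (e I x)\<^sup>2))
      = real m * (\<Sum>I\<in>Q. len I * integral {fst I..snd I} (\<lambda>x. (e I x)\<^sup>2))"
    by (simp add: sum_distrib_left mult.assoc)
  finally have int2: "has_bochner_integral lborel (\<lambda>x. ?\<rho> x * (W x)\<^sup>2) \<dots>" .
  let ?F = "\<lambda>\<omega>. (integral {a..b} f - M_alg r z a b m n Q f (\<lambda>l. T l \<omega>))\<^sup>2"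
  let ?G = "\<lambda>\<omega>. (\<mu> - 1 / real n * (\<Sum>l=1..n. W (T l \<omega>)))\<^sup>2"
  have G: "integrable M ?G" "expectation ?G = (real m * (\<Sum>I\<in>Q. len I * integral {fst I..snd I} (\<lambda>x. (e I x)\<^sup>2)) - \<mu>\<^sup>2) / real n"
    using expectation_square_sample_mean[OF indep n density \<rho>_nonneg W_meas, of \<mu>] int1 int2
    by (auto simp: has_bochner_integral_iff)
  have "(pw_lagrange r z Q f has_integral (\<Sum>I\<in>Q. integral {fst I..snd I} (?L I))) {a..b}"
  proof (rule tiling_has_integral[OF tl])
    fix I assume I: "I \<in> Q"
    show "(pw_lagrange r z Q f has_integral integral {fst I..snd I} (?L I)) {fst I..snd I}"
    proof (rule has_integral_spike_finite[of "{fst I, snd I}"])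
      show "(?L I has_integral integral {fst I..snd I} (?L I)) {fst I..snd I}"
        by (intro integrable_integral integrable_continuous_interval cont_L)
      show "pw_lagrange r z Q f x = ?L I x" if "x \<in> {fst I..snd I} - {fst I, snd I}" for x
        using cell_eq[OF tl I, of x] that by (simp add: pw_lagrange_def Let_def)
    qed simp
  qed
  moreover have "(f has_integral (\<Sum>I\<in>Q. integral {fst I..snd I} f)) {a..b}"
    by (intro tiling_has_integral[OF tl] integrable_integral integrable_continuous_interval cont_f)
  ultimately have "integral {a..b} f - integral {a..b} (pw_lagrange r z Q f)
      = (\<Sum>I\<in>Q. integral {fst I..snd I} f - integral {fst I..snd I} (?L I))"
    by (simp add: integral_unique sum_subtractf)
  also have "\<dots> = \<mu>"
    unfolding \<mu>_def e
    by (intro sum.cong refl Henstock_Kurzweil_Integration.integral_diff[symmetric] integrable_continuous_interval cont_f cont_L)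
  finally have \<mu>_eq: "integral {a..b} f - integral {a..b} (pw_lagrange r z Q f) = \<mu>" .
  \<comment> \<open>Almost surely no sample point is a breakpoint.\<close>
  define D where "D = (\<Union>I\<in>Q. {fst I<..<snd I})"
  have D: "D \<in> sets borel" using t(1) by (auto simp: D_def)
  have inD: "AE \<omega> in M. T l \<omega> \<in> D" if "l \<in> {1..n}" for l
  proof -
    have "{a..b} - D \<subseteq> (\<Union>I\<in>Q. {fst I, snd I})"
    proof
      fix x assume x: "x \<in> {a..b} - D"
      then obtain I where I: "I \<in> Q" "x \<in> {fst I..snd I}" unfolding t(6)[symmetric] by blast
      then have "\<not> (fst I < x \<and> x < snd I)" using x by (auto simp: D_def)
      then have "x = fst I \<or> x = snd I" using I(2) by auto
      then show "x \<in> (\<Union>I\<in>Q. {fst I, snd I})" using I(1) by blast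
    qed
    moreover have "finite (\<Union>I\<in>Q. {fst I, snd I})" using t(1) by simp
    ultimately have "finite ({a..b} - D)" by (rule finite_subset)
    then have "AE x in lborel. x \<notin> {a..b} - D" by (intro AE_not_in finite_imp_null_set_lborel)
    then have "AE x in lborel. 0 < ennreal (?\<rho> x) \<longrightarrow> x \<in> D"
      by eventually_elim (auto simp: rho_def split: if_splits)
    moreover have "(\<lambda>x. ennreal (?\<rho> x)) \<in> borel_measurable lborel"
      using density[OF that] by (auto simp: distributed_def)
    ultimately have "AE x in density lborel (\<lambda>x. ennreal (?\<rho> x)). x \<in> D"
      by (simp add: AE_density)
    then have "AE x in distr M lborel (T l). x \<in> D"
      by (subst distributed_distr_eq_density[OF density[OF that]])
    then show ?thesis
      using D distributed_measurable[OF density[OF that]] by (subst (asm) AE_distr_iff) auto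
  qed
  have FG: "AE \<omega> in M. ?F \<omega> = ?G \<omega>"
  proof -
    have "AE \<omega> in M. \<forall>l\<in>{1..n}. T l \<omega> \<in> D" using inD by (intro AE_finite_allI) auto
    then show ?thesis
    proof eventually_elim
      case (elim \<omega>)
      have "(f (T l \<omega>) - pw_lagrange r z Q f (T l \<omega>)) / ?\<rho> (T l \<omega>) = W (T l \<omega>)" if "l \<in> {1..n}" for l
      proof -
        have "T l \<omega> \<in> D" using elim that by blast
        then obtain I where I: "I \<in> Q" "fst I < T l \<omega>" "T l \<omega> < snd I" by (auto simp: D_def)
        have "T l \<omega> \<in> {a..b}" using I t(2,4)[OF I(1)] by auto
        then show ?thesis
          using len[OF I(1)] m
          by (simp add: W_def cellwise_eq[OF tl I] rho_def pw_lagrange_def Let_def cell_eq[OF tl I] e)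
      qed
      then have "M_alg r z a b m n Q f (\<lambda>l. T l \<omega>) = integral {a..b} (pw_lagrange r z Q f) + 1 / real n * (\<Sum>l=1..n. W (T l \<omega>))"
        unfolding M_alg_def by (intro arg_cong2[of _ _ _ _ "(+)"] arg_cong2[of _ _ _ _ "(*)"] sum.cong refl) auto
      then show ?case by (simp add: \<mu>_eq[symmetric] algebra_simps)
    qed
  qed
  have "expectation ?F \<le> expectation ?G"
  proof (cases "integrable M ?F")
    case True
    then show ?thesis using FG G(1) by (intro order_eq_refl integral_cong_AE) auto
  next
    case False
    then have "expectation ?F = 0" by (rule not_integrable_integral_eq)
    also have "0 \<le> expectation ?G" by (intro Bochner_Integration.integral_nonneg) auto
    finally show ?thesis .
  qed
  then show ?thesis using G(2) by (simp add: \<mu>_def)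
qed

section \<open>The error on a single cell\<close>

lemma continuous_on_P_poly: "continuous_on S (P_poly r z)"
proof -
  have "P_poly r z = (\<lambda>x. \<Prod>s=1..r. x - z s)" by (auto simp: P_poly_def)
  then show ?thesis by (auto intro!: continuous_intros)
qed

lemma abs_P_poly_le_1:
  assumes "\<And>s. s \<in> {1..r} \<Longrightarrow> z s \<in> {0..1}" "x \<in> {0..1}"
  shows "\<bar>P_poly r z x\<bar> \<le> 1"
  unfolding P_poly_def abs_prod
proof (rule prod_le_1)
  fix s assume "s \<in> {1..r}"
  then show "0 \<le> \<bar>x - z s\<bar> \<and> \<bar>x - z s\<bar> \<le> 1" using assms(1)[of s] assms(2) by auto
qed

lemma integral_affine_01:
  fixes F :: "real \<Rightarrow> real"
  assumes "continuous_on {0..1} F" "l < u"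
  shows "((\<lambda>x. F ((x - l) / (u - l))) has_integral (u - l) * integral {0..1} F) {l..u}"
proof -
  define h where "h = u - l"
  have h: "h > 0" "u = l + h" using assms(2) by (auto simp: h_def)
  have F: "(F has_integral integral {0..1} F) (cbox 0 1)"
    using assms(1) by (simp add: integrable_integral integrable_continuous_interval)
  have "((\<lambda>x. F ((1 / h) *\<^sub>R x + - (l / h))) has_integral (integral {0..1} F /\<^sub>R (1 / h) ^ DIM(real)))
      (cbox ((0 - - (l / h)) /\<^sub>R (1 / h)) ((1 - - (l / h)) /\<^sub>R (1 / h)))"
    by (rule has_integral_affinity'[OF F]) (use h in simp)
  moreover have "(0 - - (l / h)) /\<^sub>R (1 / h) = l" "(1 - - (l / h)) /\<^sub>R (1 / h) = u"
    using h by (simp_all add: field_simps)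
  moreover have "integral {0..1} F /\<^sub>R (1 / h) ^ DIM(real) = h * integral {0..1} F" by simp
  moreover have "(1 / h) *\<^sub>R x + - (l / h) = (x - l) / h" for x by (simp add: diff_divide_distrib)
  ultimately show ?thesis unfolding h_def by (simp only: cbox_interval)
qed

text \<open>
  The claim \<open>\<beta>\<^sup>2 \<le> \<alpha>\<^sup>2\<close> is the nonnegativity of the variance of \<^const>\<open>P_poly\<close> at a uniformly distributed point.
  The bounds by one serve to keep the error constants of the cells free of \<open>\<alpha>\<close> and \<open>\<beta>\<close>.
\<close>

lemma alpha_beta_facts:
  assumes "\<And>s. s \<in> {1..r} \<Longrightarrow> z s \<in> {0..1}"
  shows "(alpha r z)\<^sup>2 = integral {0..1} (\<lambda>x. (P_poly r z x)\<^sup>2)" "(beta r z)\<^sup>2 \<le> (alpha r z)\<^sup>2"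
    "(alpha r z)\<^sup>2 \<le> 1" "\<bar>beta r z\<bar> \<le> 1"
proof -
  note [continuous_intros] = continuous_on_P_poly
  let ?P = "P_poly r z"
  have nn: "0 \<le> integral {0..1} (\<lambda>x. (?P x)\<^sup>2)" by (intro integral_nonneg integrable_continuous_interval continuous_intros) auto
  then show a: "(alpha r z)\<^sup>2 = integral {0..1} (\<lambda>x. (?P x)\<^sup>2)" by (simp add: alpha_def)
  have P1: "(?P x)\<^sup>2 \<le> 1" if "x \<in> {0..1}" for x
    using abs_P_poly_le_1[of r z x] assms that by (simp add: abs_square_le_1)
  have "integral {0..1} (\<lambda>x. (?P x)\<^sup>2) \<le> integral {0..1::real} (\<lambda>x. 1)"
    by (rule Henstock_Kurzweil_Integration.integral_le)
       (use P1 in \<open>auto intro!: integrable_continuous_interval continuous_intros\<close>)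
  then show a1: "(alpha r z)\<^sup>2 \<le> 1" by (simp add: a)
  have "0 \<le> integral {0..1} (\<lambda>x. (?P x - beta r z)\<^sup>2)"
    by (intro integral_nonneg integrable_continuous_interval continuous_intros) auto
  also have "(\<lambda>x. (?P x - beta r z)\<^sup>2) = (\<lambda>x. (?P x)\<^sup>2 - 2 * beta r z * ?P x + (beta r z)\<^sup>2)"
    by (auto simp: power2_eq_square algebra_simps)
  also have "integral {0..1} \<dots> = integral {0..1} (\<lambda>x. (?P x)\<^sup>2) - 2 * beta r z * integral {0..1} ?P + (beta r z)\<^sup>2"
  proof (rule integral_unique)
    have "((\<lambda>x. (beta r z)\<^sup>2) has_integral (beta r z)\<^sup>2) {0..1::real}"
      using has_integral_const_real[of "(beta r z)\<^sup>2" 0 1] by simp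
    then show "((\<lambda>x. (?P x)\<^sup>2 - 2 * beta r z * ?P x + (beta r z)\<^sup>2) has_integral
        integral {0..1} (\<lambda>x. (?P x)\<^sup>2) - 2 * beta r z * integral {0..1} ?P + (beta r z)\<^sup>2) {0..1}"
      by (intro has_integral_add has_integral_diff has_integral_mult_right integrable_integral
          integrable_continuous_interval continuous_intros)
  qed
  finally show ba: "(beta r z)\<^sup>2 \<le> (alpha r z)\<^sup>2"
    by (simp only: a) (simp add: beta_def power2_eq_square)
  show "\<bar>beta r z\<bar> \<le> 1" using order_trans[OF ba a1] by (simp add: abs_square_le_1)
qed

text \<open>
  By the error formula of interpolation, the error on a cell is the scaled nodal polynomial times a value
  of \<open>\<bar>f\<^sup>(\<^sup>r\<^sup>)\<bar> / r!\<close> on the cell, up to the global sign \<open>\<sigma>\<close>. Replacing this value by the constant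
  \<open>v\<close> leaves integrals of the nodal polynomial, which scale to \<open>\<alpha>\<close> and \<open>\<beta>\<close>.
\<close>

lemma cell_error_bounds:
  fixes f :: "real \<Rightarrow> real" and r :: nat and z :: "nat \<Rightarrow> real"
  assumes r: "r \<ge> 1" and C: "C_on r {a..b} f"
    and z: "inj_on z {1..r}" "\<And>s. s \<in> {1..r} \<Longrightarrow> z s \<in> {0..1}"
    and I: "a \<le> fst I" "fst I < snd I" "snd I \<le> b"
    and \<sigma>: "\<bar>\<sigma>\<bar> = 1" "\<And>x. x \<in> {a..b} \<Longrightarrow> \<sigma> * nderiv_on {a..b} r f x \<ge> 0"
    and v: "\<And>x. x \<in> {fst I..snd I} \<Longrightarrow> \<bar>\<bar>nderiv_on {a..b} r f x\<bar> / fact r - v\<bar> \<le> \<epsilon> * v"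
    and v_pos: "v > 0" and \<epsilon>: "0 \<le> \<epsilon>"
    and e: "e = (\<lambda>x. f x - lagrange r (\<lambda>s. fst I + z s * len I) f x)"
  shows "len I * integral {fst I..snd I} (\<lambda>x. (e x)\<^sup>2) \<le> (1 + \<epsilon>)\<^sup>2 * (alpha r z)\<^sup>2 * (len I ^ (r + 1) * v)\<^sup>2"
    and "\<bar>\<sigma> * integral {fst I..snd I} e - beta r z * (len I ^ (r + 1) * v)\<bar> \<le> \<epsilon> * (len I ^ (r + 1) * v)"
proof -
  define l u h where "l = fst I" and "u = snd I" and "h = u - l"
  have lu: "a \<le> l" "l < u" "u \<le> b" using I by (auto simp: l_def u_def)
  have h: "h > 0" "len I = h" using lu by (auto simp: h_def l_def u_def len_def)
  let ?x = "\<lambda>s. l + z s * h"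
  define \<pi> where "\<pi> x = h ^ r * P_poly r z ((x - l) / h)" for x
  have prod: "(\<Prod>s=1..r. x - ?x s) = \<pi> x" for x
  proof -
    have "(\<Prod>s=1..r. x - ?x s) = (\<Prod>s=1..r. h * ((x - l) / h - z s))"
      using h by (intro prod.cong refl) (simp add: field_simps)
    then show ?thesis by (simp add: \<pi>_def P_poly_def prod.distrib)
  qed
  have nodes: "inj_on ?x {1..r}" "?x ` {1..r} \<subseteq> {l..u}"
  proof -
    show "inj_on ?x {1..r}"
    proof (rule inj_onI)
      fix s s' assume s: "s \<in> {1..r}" "s' \<in> {1..r}" "?x s = ?x s'"
      then have "z s = z s'" using h by simp
      then show "s = s'" using s(1,2) by (rule inj_onD[OF z(1)])
    qed
    have "0 \<le> z s * h" "z s * h \<le> 1 * h" if "s \<in> {1..r}" for s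
      using z(2)[OF that] h(1) by (intro mult_nonneg_nonneg mult_right_mono; simp)+
    then have "l \<le> ?x s" "?x s \<le> u" if "s \<in> {1..r}" for s
      using that unfolding h_def by fastforce+
    then show "?x ` {1..r} \<subseteq> {l..u}" by auto
  qed
  have key: "\<exists>y. \<sigma> * e x = \<pi> x * y \<and> \<bar>y - v\<bar> \<le> \<epsilon> * v" if x: "x \<in> {l..u}" for x
  proof -
    obtain \<xi> where \<xi>: "\<xi> \<in> {l..u}"
        "f x - lagrange r ?x f x = \<pi> x * (nderiv_on {a..b} r f \<xi> / fact r)"
      using lagrange_error[OF C lu(1,3) r nodes x] unfolding prod by blast
    then have ex: "e x = \<pi> x * (nderiv_on {a..b} r f \<xi> / fact r)"
      by (simp only: e h(2) l_def[symmetric])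
    have "\<sigma> * nderiv_on {a..b} r f \<xi> = \<bar>\<sigma> * nderiv_on {a..b} r f \<xi>\<bar>"
      using \<sigma>(2)[of \<xi>] \<xi>(1) lu by simp
    also have "\<dots> = \<bar>nderiv_on {a..b} r f \<xi>\<bar>" by (simp add: abs_mult \<sigma>(1))
    finally have "\<sigma> * e x = \<pi> x * (\<bar>nderiv_on {a..b} r f \<xi>\<bar> / fact r)"
      using ex by (metis mult.left_commute times_divide_eq_right)
    then show ?thesis using v[of \<xi>] \<xi>(1)
      by (intro exI[of _ "\<bar>nderiv_on {a..b} r f \<xi>\<bar> / fact r"]) (simp add: l_def u_def)
  qed
  have \<sigma>2: "\<sigma>\<^sup>2 = 1" using \<sigma>(1) by (metis one_power2 power2_abs)
  have cont_\<pi>: "continuous_on S \<pi>" for S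
  proof -
    have "continuous_on S (\<lambda>x. h ^ r * P_poly r z ((x - l) / h))"
      using h by (intro continuous_intros continuous_on_compose2[OF continuous_on_P_poly[of UNIV]]) auto
    then show ?thesis by (simp add: \<pi>_def[abs_def])
  qed
  have "continuous_on {a..b} f" using C_on_continuous[OF C, of 0] by simp
  then have "continuous_on {l..u} f" by (rule continuous_on_subset) (use lu in auto)
  moreover obtain p where "lagrange r ?x f = poly p"
    using lagrange_eq_poly[of r ?x f] by blast
  ultimately have cont_e: "continuous_on {l..u} e"
    unfolding e h(2) l_def[symmetric] by (auto intro!: continuous_intros continuous_on_poly)
  have \<pi>1: "(\<pi> has_integral h ^ r * (h * beta r z)) {l..u}"
    unfolding \<pi>_def[abs_def] beta_def h_def
    by (intro has_integral_mult_right integral_affine_01 continuous_on_P_poly lu)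
  have \<alpha>2: "(alpha r z)\<^sup>2 = integral {0..1} (\<lambda>x. (P_poly r z x)\<^sup>2)"
    by (rule alpha_beta_facts(1)) (rule z(2))
  have \<pi>2: "((\<lambda>x. (\<pi> x)\<^sup>2) has_integral (h ^ r)\<^sup>2 * (h * (alpha r z)\<^sup>2)) {l..u}"
    unfolding \<pi>_def power_mult_distrib \<alpha>2 h_def
    by (intro has_integral_mult_right integral_affine_01[OF _ lu(2), of "\<lambda>x. (P_poly r z x)\<^sup>2"]
        continuous_on_power continuous_on_P_poly)
  have sq: "(e x)\<^sup>2 \<le> (1 + \<epsilon>)\<^sup>2 * v\<^sup>2 * (\<pi> x)\<^sup>2" if x: "x \<in> {l..u}" for x
  proof -
    obtain y where y: "\<sigma> * e x = \<pi> x * y" "\<bar>y - v\<bar> \<le> \<epsilon> * v" using key[OF x] by blast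
    have "\<bar>y\<bar> \<le> (1 + \<epsilon>) * v" using y(2) v_pos by (simp add: algebra_simps abs_le_iff)
    then have "y\<^sup>2 \<le> ((1 + \<epsilon>) * v)\<^sup>2"
      using v_pos \<epsilon> by (intro abs_le_square_iff[THEN iffD1]) auto
    have "(e x)\<^sup>2 = (\<sigma> * e x)\<^sup>2" by (simp add: power_mult_distrib \<sigma>2)
    also have "\<dots> = (\<pi> x)\<^sup>2 * y\<^sup>2" by (simp add: y(1) power_mult_distrib)
    also have "\<dots> \<le> (\<pi> x)\<^sup>2 * ((1 + \<epsilon>) * v)\<^sup>2"
      using \<open>y\<^sup>2 \<le> _\<close> by (intro mult_left_mono) auto
    finally show ?thesis by (simp add: power_mult_distrib ac_simps)
  qed
  have "integral {l..u} (\<lambda>x. (e x)\<^sup>2) \<le> (1 + \<epsilon>)\<^sup>2 * v\<^sup>2 * ((h ^ r)\<^sup>2 * (h * (alpha r z)\<^sup>2))"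
    using sq by (intro has_integral_le[OF integrable_integral has_integral_mult_right[OF \<pi>2]]
        integrable_continuous_interval continuous_intros cont_e) auto
  then have "h * integral {l..u} (\<lambda>x. (e x)\<^sup>2) \<le> h * ((1 + \<epsilon>)\<^sup>2 * v\<^sup>2 * ((h ^ r)\<^sup>2 * (h * (alpha r z)\<^sup>2)))"
    using h by (intro mult_left_mono) auto
  also have "\<dots> = (1 + \<epsilon>)\<^sup>2 * (alpha r z)\<^sup>2 * (h ^ (r + 1) * v)\<^sup>2"
    by (simp add: power_mult_distrib power2_eq_square ac_simps)
  finally show "len I * integral {fst I..snd I} (\<lambda>x. (e x)\<^sup>2) \<le> (1 + \<epsilon>)\<^sup>2 * (alpha r z)\<^sup>2 * (len I ^ (r + 1) * v)\<^sup>2"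
    by (simp add: h(2) l_def u_def)
  have diff: "\<bar>\<sigma> * e x - v * \<pi> x\<bar> \<le> \<epsilon> * v * h ^ r" if x: "x \<in> {l..u}" for x
  proof -
    obtain y where y: "\<sigma> * e x = \<pi> x * y" "\<bar>y - v\<bar> \<le> \<epsilon> * v" using key[OF x] by blast
    have "(x - l) / h \<in> {0..1}" using x h by (auto simp: h_def)
    then have "\<bar>\<pi> x\<bar> \<le> h ^ r * 1"
      unfolding \<pi>_def abs_mult using h abs_P_poly_le_1[of r z, OF z(2)] by (intro mult_mono) auto
    moreover have "\<bar>\<sigma> * e x - v * \<pi> x\<bar> = \<bar>\<pi> x\<bar> * \<bar>y - v\<bar>"
      unfolding y(1) by (simp add: abs_mult[symmetric] algebra_simps)
    ultimately have "\<bar>\<sigma> * e x - v * \<pi> x\<bar> \<le> h ^ r * (\<epsilon> * v)"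
      using y(2) h by (auto intro!: mult_mono)
    then show ?thesis by (simp add: ac_simps)
  qed
  have int: "((\<lambda>x. \<sigma> * e x - v * \<pi> x) has_integral \<sigma> * integral {l..u} e - v * (h ^ r * (h * beta r z))) {l..u}"
    by (intro has_integral_diff has_integral_mult_right integrable_integral integrable_continuous_interval cont_e \<pi>1)
  have "norm (\<sigma> * integral {l..u} e - v * (h ^ r * (h * beta r z))) \<le> \<epsilon> * v * h ^ r * measure lborel (cbox l u)"
    using int diff \<epsilon> v_pos h by (intro has_integral_bound[where f = "\<lambda>x. \<sigma> * e x - v * \<pi> x"]) auto
  then show "\<bar>\<sigma> * integral {fst I..snd I} e - beta r z * (len I ^ (r + 1) * v)\<bar> \<le> \<epsilon> * (len I ^ (r + 1) * v)"
    using lu by (simp add: h(2) l_def[symmetric] u_def[symmetric] h_def[symmetric] ac_simps)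
qed

text \<open>
  The two terms below are, up to division by \<open>n\<close>, the mean square error, in which the integral error \<open>E1\<close>
  enters with a negative sign and needs a lower bound. The Cauchy--Schwarz inequality absorbs its
  perturbation into the sum of squares.
\<close>

lemma sum_cell_errors_le:
  fixes A E2 E1 :: "'i \<Rightarrow> real"
  assumes Q: "finite Q" "card Q = m" and A: "\<And>I. I \<in> Q \<Longrightarrow> A I > 0"
    and E2: "\<And>I. I \<in> Q \<Longrightarrow> E2 I \<le> (1 + \<epsilon>)\<^sup>2 * \<alpha>\<^sup>2 * (A I)\<^sup>2"
    and E1: "\<And>I. I \<in> Q \<Longrightarrow> \<bar>\<sigma> * E1 I - \<beta> * A I\<bar> \<le> \<epsilon> * A I"
    and \<sigma>: "\<bar>\<sigma>\<bar> = 1" and \<epsilon>: "0 \<le> \<epsilon>" "\<epsilon> \<le> 1" and \<alpha>\<beta>: "\<alpha>\<^sup>2 \<le> 1" "\<bar>\<beta>\<bar> \<le> (1::real)"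
  shows "real m * sum E2 Q - (sum E1 Q)\<^sup>2
    \<le> \<alpha>\<^sup>2 * real m * (\<Sum>I\<in>Q. (A I)\<^sup>2) - \<beta>\<^sup>2 * (sum A Q)\<^sup>2 + 5 * \<epsilon> * (real m * (\<Sum>I\<in>Q. (A I)\<^sup>2))"
proof -
  define s1 s2 where "s1 = sum A Q" and "s2 = real m * (\<Sum>I\<in>Q. (A I)\<^sup>2)"
  have s1: "0 \<le> s1" unfolding s1_def using A by (intro sum_nonneg) (simp add: less_imp_le)
  have s12: "s1\<^sup>2 \<le> s2"
    using sum_squared_le_sum_of_squares[of A Q] Q(2) by (simp add: s1_def s2_def mult.commute)
  then have s2: "0 \<le> s2" by (rule order_trans[rotated]) simp
  have "real m * sum E2 Q \<le> real m * (\<Sum>I\<in>Q. (1 + \<epsilon>)\<^sup>2 * \<alpha>\<^sup>2 * (A I)\<^sup>2)"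
    using E2 by (intro mult_left_mono sum_mono) auto
  also have "\<dots> = (1 + \<epsilon>)\<^sup>2 * \<alpha>\<^sup>2 * s2" by (simp add: s2_def sum_distrib_left ac_simps)
  also have "\<dots> \<le> \<alpha>\<^sup>2 * s2 + 3 * \<epsilon> * s2"
  proof -
    have "\<epsilon> * \<epsilon> \<le> \<epsilon> * 1" using \<epsilon> by (intro mult_left_mono) auto
    then have "(1 + \<epsilon>)\<^sup>2 \<le> 1 + 3 * \<epsilon>" by (simp add: power2_eq_square algebra_simps)
    then have "(1 + \<epsilon>)\<^sup>2 * (\<alpha>\<^sup>2 * s2) \<le> (1 + 3 * \<epsilon>) * (\<alpha>\<^sup>2 * s2)" using s2 by (intro mult_right_mono) auto
    moreover have "3 * \<epsilon> * (\<alpha>\<^sup>2 * s2) \<le> 3 * \<epsilon> * (1 * s2)"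
      using \<epsilon> \<alpha>\<beta> s2 by (intro mult_left_mono mult_right_mono) auto
    ultimately show ?thesis by (simp add: algebra_simps)
  qed
  finally have 2: "real m * sum E2 Q \<le> \<alpha>\<^sup>2 * s2 + 3 * \<epsilon> * s2" .
  define X where "X = \<sigma> * sum E1 Q"
  have "\<bar>X - \<beta> * s1\<bar> = \<bar>\<Sum>I\<in>Q. \<sigma> * E1 I - \<beta> * A I\<bar>"
    by (simp add: X_def s1_def sum_subtractf sum_distrib_left)
  also have "\<dots> \<le> (\<Sum>I\<in>Q. \<epsilon> * A I)"
    using E1 by (intro order_trans[OF sum_abs] sum_mono)
  also have "\<dots> = \<epsilon> * s1" by (simp add: s1_def sum_distrib_left)
  finally have X: "\<bar>X - \<beta> * s1\<bar> \<le> \<epsilon> * s1" .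
  have "\<bar>\<beta> * s1 * (X - \<beta> * s1)\<bar> \<le> (1 * s1) * (\<epsilon> * s1)"
    unfolding abs_mult using X \<alpha>\<beta> s1 \<epsilon> by (intro mult_mono) auto
  then have "- (\<epsilon> * s1\<^sup>2) \<le> \<beta> * s1 * (X - \<beta> * s1)" by (simp add: power2_eq_square abs_le_iff ac_simps)
  moreover have "0 \<le> (X - \<beta> * s1)\<^sup>2" by simp
  then have "\<beta>\<^sup>2 * s1\<^sup>2 + 2 * (\<beta> * s1 * (X - \<beta> * s1)) \<le> X\<^sup>2"
    by (simp add: power2_eq_square algebra_simps)
  ultimately have "\<beta>\<^sup>2 * s1\<^sup>2 - 2 * (\<epsilon> * s1\<^sup>2) \<le> X\<^sup>2" by linarith
  moreover have "\<epsilon> * s1\<^sup>2 \<le> \<epsilon> * s2" using s12 \<epsilon> by (intro mult_left_mono)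
  moreover have "X\<^sup>2 = (sum E1 Q)\<^sup>2"
    using \<sigma> by (metis X_def mult_1 one_power2 power2_abs power_mult_distrib)
  ultimately show ?thesis using 2 by (simp add: s1_def s2_def mult.assoc)
qed

section \<open>The bound for a fixed partition\<close>

text \<open>
  The first claim is the definition of \<^const>\<open>K_mr\<close>, solved for the quantity under the root. The second
  one makes an error that is small relative to the sum of squares small relative to \<open>N\<close>: each summand is
  at most \<open>4 ^ (r + 1)\<close> times the smallest one, and \<open>N\<close> is at least \<open>m ^ (r + 1)\<close> times the minimum of \<open>A\<close>.
\<close>

lemma K_mr_of_cells:
  fixes A :: "ivl \<Rightarrow> real"
  assumes Q: "finite Q" "card Q = m" "m \<ge> 1" and A: "\<And>I. I \<in> Q \<Longrightarrow> A I > 0"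
    and ratio: "\<And>I J. I \<in> Q \<Longrightarrow> J \<in> Q \<Longrightarrow> A I \<le> 2 ^ (r + 1) * A J"
    and \<gamma>: "(beta r z)\<^sup>2 < (alpha r z)\<^sup>2"
    and N: "N = (\<Sum>I\<in>Q. A I powr (1 / (real r + 1))) ^ (r + 1)"
  shows "\<exists>B\<in>admissible r m. K_mr r z m B \<ge> 0 \<and>
      (alpha r z)\<^sup>2 * real m * (\<Sum>I\<in>Q. (A I)\<^sup>2) - (beta r z)\<^sup>2 * (sum A Q)\<^sup>2
        = ((alpha r z)\<^sup>2 - (beta r z)\<^sup>2) * (K_mr r z m B)\<^sup>2 * (N / real m ^ r)\<^sup>2"
    and "real m * (\<Sum>I\<in>Q. (A I)\<^sup>2) \<le> 4 ^ (r + 1) * (N / real m ^ r)\<^sup>2"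
proof -
  define q where "q = 1 / (real r + 1)"
  have q: "q > 0" by (simp add: q_def)
  define \<gamma> where "\<gamma> = (alpha r z)\<^sup>2 - (beta r z)\<^sup>2"
  have \<gamma>_pos: "\<gamma> > 0" using \<gamma> by (simp add: \<gamma>_def)
  have Qne: "Q \<noteq> {}" using Q by auto
  have A_q: "A I powr q > 0" if "I \<in> Q" for I using A[OF that] by simp
  have N_pos: "N > 0"
  proof -
    have "0 < (\<Sum>I\<in>Q. A I powr q)" using Q(1) Qne A_q by (intro sum_pos)
    then show ?thesis unfolding N q_def by (rule zero_less_power)
  qed
  obtain \<phi> where \<phi>: "bij_betw \<phi> {1..m} Q"
    using ex_bij_betw_nat_finite_1[OF Q(1)] Q(2) by auto
  define B where "B i = A (\<phi> i)" for i
  have \<phi>Q: "\<phi> i \<in> Q" if "i \<in> {1..m}" for i using \<phi> that by (auto simp: bij_betw_def)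
  have B: "B \<in> admissible r m"
    using A ratio \<phi>Q by (auto simp: admissible_def B_def divide_le_eq)
  have sum_B: "(\<Sum>i=1..m. F (B i)) = (\<Sum>I\<in>Q. F (A I))" for F :: "real \<Rightarrow> real"
    unfolding B_def by (rule sum.reindex_bij_betw[OF \<phi>])
  have B_pos: "B i > 0" if "i \<in> {1..m}" for i using A \<phi>Q[OF that] by (simp add: B_def)
  have n2: "(pnorm m 2 B)\<^sup>2 = (\<Sum>I\<in>Q. (A I)\<^sup>2)"
  proof -
    have "(pnorm m 2 B)\<^sup>2 = (\<Sum>i=1..m. B i powr 2)"
      by (simp add: pnorm_def powr_half_sqrt sum_nonneg)
    also have "\<dots> = (\<Sum>I\<in>Q. A I powr 2)" by (rule sum_B)
    also have "\<dots> = (\<Sum>I\<in>Q. (A I)\<^sup>2)" using A by (intro sum.cong refl) (simp add: powr_numeral less_imp_le)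
    finally show ?thesis .
  qed
  have n1: "pnorm m 1 B = sum A Q"
  proof -
    have "pnorm m 1 B = \<bar>\<Sum>i=1..m. B i powr 1\<bar>" by (simp add: pnorm_def)
    also have "(\<Sum>i=1..m. B i powr 1) = (\<Sum>I\<in>Q. A I powr 1)" by (rule sum_B)
    also have "\<dots> = sum A Q" using A by (intro sum.cong refl) (simp add: less_imp_le)
    also have "\<bar>sum A Q\<bar> = sum A Q" using A by (intro abs_of_nonneg sum_nonneg) (simp add: less_imp_le)
    finally show ?thesis .
  qed
  have nq: "pnorm m (1 / (real r + 1)) B = N"
  proof -
    have "pnorm m (1 / (real r + 1)) B = (\<Sum>I\<in>Q. A I powr q) powr (real r + 1)"
      unfolding pnorm_def sum_B[of "\<lambda>x. x powr (1 / (real r + 1))"] by (simp add: q_def)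
    also have "\<dots> = (\<Sum>I\<in>Q. A I powr q) powr real (r + 1)" by (simp add: add.commute)
    also have "\<dots> = N"
      unfolding N q_def[symmetric] using Q(1) Qne A_q by (intro powr_realpow sum_pos)
    finally show ?thesis .
  qed
  define V where "V = (alpha r z)\<^sup>2 * real m * (\<Sum>I\<in>Q. (A I)\<^sup>2) - (beta r z)\<^sup>2 * (sum A Q)\<^sup>2"
  have V: "V \<ge> 0"
  proof -
    have "(beta r z)\<^sup>2 * (sum A Q)\<^sup>2 \<le> (alpha r z)\<^sup>2 * ((\<Sum>I\<in>Q. (A I)\<^sup>2) * real m)"
      using sum_squared_le_sum_of_squares[of A Q] Q(2) \<gamma> by (intro mult_mono) auto
    then show ?thesis by (simp add: V_def ac_simps)
  qed
  have "K_mr r z m B = sqrt (V / \<gamma>) / N * real m ^ r"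
  proof -
    have "(kappa_alpha r z)\<^sup>2 = (alpha r z)\<^sup>2 / \<gamma>" "(kappa_beta r z)\<^sup>2 = (beta r z)\<^sup>2 / \<gamma>"
      using \<gamma>_pos by (simp_all add: kappa_alpha_def kappa_beta_def power_divide flip: \<gamma>_def)
    then show ?thesis
      unfolding K_mr_def n1 n2 nq by (simp add: V_def diff_divide_distrib)
  qed
  then have "K_mr r z m B \<ge> 0" "V = \<gamma> * (K_mr r z m B)\<^sup>2 * (N / real m ^ r)\<^sup>2"
    using V \<gamma>_pos N_pos Q(3) by (simp_all add: power_mult_distrib power_divide)
  then show "\<exists>B\<in>admissible r m. K_mr r z m B \<ge> 0 \<and>
      (alpha r z)\<^sup>2 * real m * (\<Sum>I\<in>Q. (A I)\<^sup>2) - (beta r z)\<^sup>2 * (sum A Q)\<^sup>2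
        = ((alpha r z)\<^sup>2 - (beta r z)\<^sup>2) * (K_mr r z m B)\<^sup>2 * (N / real m ^ r)\<^sup>2"
    using B by (auto simp: V_def \<gamma>_def)
  define \<mu> where "\<mu> = Min (A ` Q)"
  have "\<mu> \<in> A ` Q" using Q(1) Qne by (simp add: \<mu>_def)
  then obtain I0 where I0: "I0 \<in> Q" "\<mu> = A I0" by auto
  have \<mu>_pos: "\<mu> > 0" using A I0 by simp
  have \<mu>_le: "\<mu> \<le> A I" if "I \<in> Q" for I using that Q(1) by (simp add: \<mu>_def)
  have "real m * \<mu> powr q = (\<Sum>I\<in>Q. \<mu> powr q)" by (simp add: Q(2))
  also have "\<dots> \<le> (\<Sum>I\<in>Q. A I powr q)"
    using \<mu>_le \<mu>_pos q by (intro sum_mono powr_mono2) auto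
  finally have "(real m * \<mu> powr q) ^ (r + 1) \<le> N"
    unfolding N q_def[symmetric] by (intro power_mono) auto
  also have "(real m * \<mu> powr q) ^ (r + 1) = real m ^ (r + 1) * \<mu>"
  proof -
    have "(\<mu> powr q) ^ (r + 1) = (\<mu> powr q) powr real (r + 1)"
      using \<mu>_pos by (intro powr_realpow[symmetric]) auto
    also have "\<dots> = \<mu>" using \<mu>_pos by (simp add: powr_powr q_def add.commute)
    finally show ?thesis by (simp only: power_mult_distrib)
  qed
  finally have "real m * \<mu> \<le> N / real m ^ r" using Q(3) by (simp add: field_simps)
  then have "(real m * \<mu>)\<^sup>2 \<le> (N / real m ^ r)\<^sup>2" using \<mu>_pos by (intro power_mono) auto
  have "real m * (\<Sum>I\<in>Q. (A I)\<^sup>2) \<le> real m * (\<Sum>I\<in>Q. (2 ^ (r + 1) * \<mu>)\<^sup>2)"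
    using ratio[OF _ I0(1)] I0(2) A by (intro mult_left_mono sum_mono power_mono) (auto intro: less_imp_le)
  also have "\<dots> = ((2 ^ (r + 1))\<^sup>2) * (real m * \<mu>)\<^sup>2"
    by (simp add: Q(2) power2_eq_square ac_simps)
  also have "((2::real) ^ (r + 1))\<^sup>2 = 4 ^ (r + 1)"
    by (simp only: power_mult[symmetric] mult.commute[of "r + 1"]) (simp only: power_mult power2_eq_square, simp)
  also have "4 ^ (r + 1) * (real m * \<mu>)\<^sup>2 \<le> 4 ^ (r + 1) * (N / real m ^ r)\<^sup>2"
    using \<open>(real m * \<mu>)\<^sup>2 \<le> _\<close> by (intro mult_left_mono) auto
  finally show "real m * (\<Sum>I\<in>Q. (A I)\<^sup>2) \<le> 4 ^ (r + 1) * (N / real m ^ r)\<^sup>2" .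
qed

text \<open>
  The exponent \<open>1 / (r + 1)\<close> turns \<open>len I ^ (r + 1)\<close> into the length itself, so that the norm on the left is the power of a
  Riemann sum, and this sum is bounded cell by cell by the integral.
\<close>

lemma cell_norm_le_integral:
  fixes g :: "real \<Rightarrow> real"
  assumes tl: "tiling a b Q" and cont: "continuous_on {a..b} g" and pos: "\<And>x. x \<in> {a..b} \<Longrightarrow> g x > 0"
    and v_pos: "\<And>I. I \<in> Q \<Longrightarrow> v I > 0"
    and v: "\<And>I x. I \<in> Q \<Longrightarrow> x \<in> {fst I..snd I} \<Longrightarrow> (1 - \<epsilon>) * v I \<le> g x"
    and \<epsilon>: "0 \<le> \<epsilon>" "\<epsilon> < 1"
  shows "(\<Sum>I\<in>Q. (len I ^ (r + 1) * v I) powr (1 / (real r + 1))) ^ (r + 1)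
    \<le> integral {a..b} (\<lambda>x. g x powr (1 / (real r + 1))) ^ (r + 1) / (1 - \<epsilon>)"
proof -
  note t = tilingD[OF tl]
  define q where "q = 1 / (real r + 1)"
  have q: "q > 0" by (simp add: q_def)
  have len: "len I > 0" if "I \<in> Q" for I using t(3)[OF that] by (simp add: len_def)
  have cancel: "(x ^ (r + 1)) powr q = x" "(x powr q) ^ (r + 1) = x" if "x > 0" for x :: real
  proof -
    have "(x ^ (r + 1)) powr q = (x powr real (r + 1)) powr q"
      using powr_realpow[OF that, of "r + 1"] by simp
    then show "(x ^ (r + 1)) powr q = x" using that by (simp add: powr_powr q_def add.commute)
    have "(x powr q) ^ (r + 1) = (x powr q) powr real (r + 1)"
      using that by (intro powr_realpow[symmetric]) auto
    then show "(x powr q) ^ (r + 1) = x" using that by (simp add: powr_powr q_def add.commute)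
  qed
  have cont_q: "continuous_on S (\<lambda>x. g x powr q)" if "S \<subseteq> {a..b}" for S
    using pos that by (intro continuous_intros continuous_on_subset[OF cont that]) fastforce+
  define S where "S = (\<Sum>I\<in>Q. (len I ^ (r + 1) * v I) powr q)"
  have S: "S \<ge> 0" by (simp add: S_def sum_nonneg)
  have local: "(1 - \<epsilon>) powr q * (len I ^ (r + 1) * v I) powr q \<le> integral {fst I..snd I} (\<lambda>x. g x powr q)"
    if I: "I \<in> Q" for I
  proof -
    have "((\<lambda>x. ((1 - \<epsilon>) * v I) powr q) has_integral len I * ((1 - \<epsilon>) * v I) powr q) {fst I..snd I}"
      using has_integral_const_real[of "((1 - \<epsilon>) * v I) powr q" "fst I" "snd I"] t(3)[OF I]
      by (simp add: len_def)
    then have "len I * ((1 - \<epsilon>) * v I) powr q \<le> integral {fst I..snd I} (\<lambda>x. g x powr q)"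
    proof (rule has_integral_le)
      show "((\<lambda>x. g x powr q) has_integral integral {fst I..snd I} (\<lambda>x. g x powr q)) {fst I..snd I}"
        using t(2,4)[OF I] by (intro integrable_integral integrable_continuous_interval cont_q) auto
      show "((1 - \<epsilon>) * v I) powr q \<le> g x powr q" if "x \<in> {fst I..snd I}" for x
        using v[OF I that] v_pos[OF I] \<epsilon> q by (intro powr_mono2) auto
    qed
    moreover have "(len I ^ (r + 1) * v I) powr q = len I * v I powr q"
      using powr_mult[of "len I ^ (r + 1)" "v I" q] len[OF I] v_pos[OF I]
      unfolding cancel(1)[OF len[OF I]] by simp
    moreover have "((1 - \<epsilon>) * v I) powr q = (1 - \<epsilon>) powr q * v I powr q"
      by (rule powr_mult)
    ultimately show ?thesis by (simp only: mult.left_commute)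
  qed
  have int: "((\<lambda>x. g x powr q) has_integral (\<Sum>I\<in>Q. integral {fst I..snd I} (\<lambda>x. g x powr q))) {a..b}"
    using t(2,4) by (intro tiling_has_integral[OF tl] integrable_integral integrable_continuous_interval cont_q) fastforce
  have "(1 - \<epsilon>) powr q * S \<le> integral {a..b} (\<lambda>x. g x powr q)"
    unfolding integral_unique[OF int] S_def sum_distrib_left using local by (intro sum_mono)
  then have "((1 - \<epsilon>) powr q * S) ^ (r + 1) \<le> integral {a..b} (\<lambda>x. g x powr q) ^ (r + 1)"
    using S by (intro power_mono) auto
  also have "((1 - \<epsilon>) powr q * S) ^ (r + 1) = (1 - \<epsilon>) * S ^ (r + 1)"
    unfolding power_mult_distrib using cancel(2)[of "1 - \<epsilon>"] \<epsilon> by simp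
  finally show ?thesis using \<epsilon> by (simp add: S_def q_def pos_le_divide_eq mult.commute)
qed

text \<open>
  The estimate behind the theorem for fixed \<open>m\<close> and \<open>n\<close>: \<open>S\<close> stands for any bound on \<^const>\<open>K_mr\<close>, later
  \<open>K_star + \<epsilon>\<close>. The threshold \<open>m0\<close> is independent of \<open>n\<close>, of the partition and of the random points.
\<close>

lemma rms_error_le:
  fixes f :: "real \<Rightarrow> real" and pts :: "ivl \<Rightarrow> nat \<Rightarrow> real"
  assumes r: "r \<ge> 1" and ab: "a < b"
    and z: "inj_on z {1..r}" "\<And>s. s \<in> {1..r} \<Longrightarrow> z s \<in> {0..1}"
    and C: "C_on r {a..b} f"
    and \<sigma>: "\<bar>\<sigma>\<bar> = 1" "\<And>x. x \<in> {a..b} \<Longrightarrow> \<sigma> * nderiv_on {a..b} r f x > 0"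
    and pts: "\<And>l u. a \<le> l \<Longrightarrow> l < u \<Longrightarrow> u \<le> b \<Longrightarrow>
      inj_on (pts (l, u)) {0..r} \<and> pts (l, u) ` {0..r} \<subseteq> {l..u}"
    and \<gamma>: "(beta r z)\<^sup>2 < (alpha r z)\<^sup>2" and \<epsilon>: "0 < \<epsilon>" "\<epsilon> < 1"
  shows "\<exists>m0. \<forall>m\<ge>m0. \<forall>n\<ge>1. \<forall>Q (M :: 'w measure) T S.
    partition_result (priority r pts f) a b m Q \<longrightarrow> prob_space M \<longrightarrow>
    prob_space.indep_vars M (\<lambda>_. borel) T {1..n} \<longrightarrow>
    (\<forall>l\<in>{1..n}. distributed M lborel (T l) (\<lambda>x. ennreal (rho a b m Q x))) \<longrightarrow>
    (\<forall>A\<in>admissible r m. K_mr r z m A \<le> S) \<longrightarrow>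
    sqrt (prob_space.expectation M (\<lambda>\<omega>. (integral {a..b} f - M_alg r z a b m n Q f (\<lambda>l. T l \<omega>))\<^sup>2))
    \<le> integral {a..b} (\<lambda>x. \<bar>nderiv_on {a..b} r f x\<bar> powr (1 / (real r + 1))) ^ (r + 1) / fact r / (1 - \<epsilon>)
      * sqrt (((alpha r z)\<^sup>2 - (beta r z)\<^sup>2) * S\<^sup>2 + 5 * \<epsilon> * 4 ^ (r + 1)) / (real m ^ r * sqrt (real n))"
proof -
  let ?D = "nderiv_on {a..b} r f"
  define J where "J = integral {a..b} (\<lambda>x. \<bar>?D x\<bar> powr (1 / (real r + 1)))"
  define \<gamma> where "\<gamma> = (alpha r z)\<^sup>2 - (beta r z)\<^sup>2"
  have \<gamma>_pos: "\<gamma> > 0" using \<gamma> by (simp add: \<gamma>_def)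
  define g where "g x = \<bar>?D x\<bar> / fact r" for x
  have g_pos: "g x > 0" if "x \<in> {a..b}" for x
  proof -
    have "?D x \<noteq> 0" using \<sigma>(2)[OF that] by auto
    then show ?thesis unfolding g_def by (intro divide_pos_pos) auto
  qed
  have g_cont: "continuous_on {a..b} g"
    unfolding g_def using C_on_continuous[OF C, of r] by (intro continuous_intros) auto
  have J_eq: "integral {a..b} (\<lambda>x. g x powr (1 / (real r + 1))) ^ (r + 1) = J ^ (r + 1) / fact r"
  proof -
    have "g x powr (1 / (real r + 1)) = \<bar>?D x\<bar> powr (1 / (real r + 1)) / fact r powr (1 / (real r + 1))" for x
      by (simp add: g_def powr_divide)
    then have "integral {a..b} (\<lambda>x. g x powr (1 / (real r + 1))) = J / fact r powr (1 / (real r + 1))"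
      by (simp add: J_def)
    moreover have "(fact r powr (1 / (real r + 1))) ^ (r + 1) = (fact r :: real)"
    proof -
      have "(fact r powr (1 / (real r + 1))) ^ (r + 1) = (fact r powr (1 / (real r + 1))) powr real (r + 1)"
        by (intro powr_realpow[symmetric]) simp
      also have "\<dots> = (fact r :: real)" by (simp add: powr_powr add.commute)
      finally show ?thesis .
    qed
    ultimately show ?thesis by (simp only: power_divide)
  qed
  have prio: "priority r pts f = (\<lambda>I. len I ^ (r + 1) * \<bar>divdiff f (pts I) 0 r\<bar>)"
    by (rule ext) (simp add: priority_def)
  have mv: "\<exists>\<xi>\<in>{fst I..snd I}. \<bar>divdiff f (pts I) 0 r\<bar> = g \<xi>"
    if I: "a \<le> fst I" "fst I < snd I" "snd I \<le> b" for I
  proof -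
    obtain \<xi> where "\<xi> \<in> {fst I..snd I}" "divdiff f (pts I) 0 r = ?D \<xi> / fact r"
      using divdiff_mean_value[OF C I(1,3), of "pts I"] pts[OF I] by auto
    then show ?thesis by (intro bexI[of _ \<xi>]) (simp_all add: g_def)
  qed
  obtain m0 where m0: "\<And>m Q. m \<ge> m0 \<Longrightarrow> partition_result (priority r pts f) a b m Q \<Longrightarrow>
    (\<exists>v. (\<forall>I\<in>Q. v I > 0) \<and>
      (\<forall>I\<in>Q. \<forall>J\<in>Q. len I ^ (r + 1) * v I \<le> 2 ^ (r + 1) * (len J ^ (r + 1) * v J)) \<and>
      (\<forall>I\<in>Q. \<forall>x\<in>{fst I..snd I}. \<bar>g x - v I\<bar> \<le> \<epsilon> * v I))"
    using partition_result_balanced[OF ab _ \<epsilon>(1) less_imp_le[OF \<epsilon>(2)] g_cont g_pos mv, of "r + 1"]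
    unfolding prio by auto
  show ?thesis
    \<comment> \<open>The successor ensures \<open>m \<ge> 1\<close>.\<close>
  proof (intro exI[of _ "Suc m0"] allI impI)
    fix m n :: nat and Q and M :: "'w measure" and T and S :: real
    assume m: "Suc m0 \<le> m" and n: "1 \<le> n" and Q: "partition_result (priority r pts f) a b m Q"
      and prob: "prob_space M" and indep: "prob_space.indep_vars M (\<lambda>_. borel) T {1..n}"
      and density: "\<forall>l\<in>{1..n}. distributed M lborel (T l) (\<lambda>x. ennreal (rho a b m Q x))"
      and S: "\<forall>A\<in>admissible r m. K_mr r z m A \<le> S"
    have m1: "m \<ge> 1" using m by simp
    have tl: "tiling a b Q" and card: "card Q = m" using partition_result_tiling[OF Q ab] by auto
    note t = tilingD[OF tl]
    obtain v where v_pos: "\<And>I. I \<in> Q \<Longrightarrow> v I > 0"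
      and ratio: "\<And>I J. I \<in> Q \<Longrightarrow> J \<in> Q \<Longrightarrow> len I ^ (r + 1) * v I \<le> 2 ^ (r + 1) * (len J ^ (r + 1) * v J)"
      and v: "\<And>I x. I \<in> Q \<Longrightarrow> x \<in> {fst I..snd I} \<Longrightarrow> \<bar>g x - v I\<bar> \<le> \<epsilon> * v I"
      using m0[OF Suc_leD[OF m] Q] by blast
    define A where "A I = len I ^ (r + 1) * v I" for I
    have A: "A I > 0" if "I \<in> Q" for I
      using v_pos[OF that] t(3)[OF that] by (simp add: A_def len_def)
    define e where "e = (\<lambda>I x. f x - lagrange r (\<lambda>s. fst I + z s * len I) f x)"
    define E2 where "E2 I = len I * integral {fst I..snd I} (\<lambda>x. (e I x)\<^sup>2)" for I
    define E1 where "E1 I = integral {fst I..snd I} (e I)" for I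
    have err: "E2 I \<le> (1 + \<epsilon>)\<^sup>2 * (alpha r z)\<^sup>2 * (A I)\<^sup>2" "\<bar>\<sigma> * E1 I - beta r z * A I\<bar> \<le> \<epsilon> * A I"
      if I: "I \<in> Q" for I
      unfolding E1_def E2_def A_def
      using cell_error_bounds[OF r C z t(2-4)[OF I] \<sigma>(1) less_imp_le[OF \<sigma>(2)] v[OF I, unfolded g_def] v_pos[OF I]
          less_imp_le[OF \<epsilon>(1)], of "e I"] by (auto simp: e_def)
    define N where "N = (\<Sum>I\<in>Q. A I powr (1 / (real r + 1))) ^ (r + 1)"
    have N: "0 \<le> N" "N \<le> J ^ (r + 1) / fact r / (1 - \<epsilon>)"
    proof -
      show "0 \<le> N" unfolding N_def by (intro zero_le_power sum_nonneg) simp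
      have "(1 - \<epsilon>) * v I \<le> g x" if "I \<in> Q" "x \<in> {fst I..snd I}" for I x
        using v[OF that] by (simp add: algebra_simps abs_le_iff)
      from cell_norm_le_integral[where r = r, OF tl g_cont g_pos v_pos this less_imp_le[OF \<epsilon>(1)] \<epsilon>(2)]
      show "N \<le> J ^ (r + 1) / fact r / (1 - \<epsilon>)" unfolding J_eq N_def A_def by simp
    qed
    have ab_facts: "(alpha r z)\<^sup>2 \<le> 1" "\<bar>beta r z\<bar> \<le> 1"
      using alpha_beta_facts(3,4)[of r z] z(2) by blast+
    obtain B where B: "B \<in> admissible r m" "K_mr r z m B \<ge> 0"
        "(alpha r z)\<^sup>2 * real m * (\<Sum>I\<in>Q. (A I)\<^sup>2) - (beta r z)\<^sup>2 * (sum A Q)\<^sup>2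
          = \<gamma> * (K_mr r z m B)\<^sup>2 * (N / real m ^ r)\<^sup>2"
      and sum_sq: "real m * (\<Sum>I\<in>Q. (A I)\<^sup>2) \<le> 4 ^ (r + 1) * (N / real m ^ r)\<^sup>2"
      using K_mr_of_cells[OF t(1) card m1 A ratio[folded A_def] \<gamma> N_def] unfolding \<gamma>_def by auto
    have "(K_mr r z m B)\<^sup>2 \<le> S\<^sup>2" using B(1,2) S by (intro power_mono) auto
    have "real m * sum E2 Q - (sum E1 Q)\<^sup>2
        \<le> \<gamma> * (K_mr r z m B)\<^sup>2 * (N / real m ^ r)\<^sup>2 + 5 * \<epsilon> * (real m * (\<Sum>I\<in>Q. (A I)\<^sup>2))"
      unfolding B(3)[symmetric]
      by (rule sum_cell_errors_le[OF t(1) card A err(1) err(2) \<sigma>(1) _ _ ab_facts]) (use \<epsilon> in auto)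
    also have "\<dots> \<le> \<gamma> * S\<^sup>2 * (N / real m ^ r)\<^sup>2 + 5 * \<epsilon> * (4 ^ (r + 1) * (N / real m ^ r)\<^sup>2)"
      using \<open>(K_mr r z m B)\<^sup>2 \<le> S\<^sup>2\<close> sum_sq \<gamma>_pos \<epsilon>
      by (intro add_mono mult_left_mono mult_right_mono) auto
    also have "\<dots> = (\<gamma> * S\<^sup>2 + 5 * \<epsilon> * 4 ^ (r + 1)) * (N / real m ^ r)\<^sup>2" by (simp add: algebra_simps)
    finally have V: "real m * sum E2 Q - (sum E1 Q)\<^sup>2 \<le> (\<gamma> * S\<^sup>2 + 5 * \<epsilon> * 4 ^ (r + 1)) * (N / real m ^ r)\<^sup>2" .
    have cont_f: "continuous_on {a..b} f" using C_on_continuous[OF C, of 0] by simp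
    have "prob_space.expectation M (\<lambda>\<omega>. (integral {a..b} f - M_alg r z a b m n Q f (\<lambda>l. T l \<omega>))\<^sup>2)
        \<le> (real m * sum E2 Q - (sum E1 Q)\<^sup>2) / real n"
      using mean_square_error_le[OF ab tl m1 n prob indep _ cont_f e_def] density
      unfolding E1_def E2_def by blast
    also have "\<dots> \<le> (\<gamma> * S\<^sup>2 + 5 * \<epsilon> * 4 ^ (r + 1)) * (N / real m ^ r)\<^sup>2 / real n"
      using V by (intro divide_right_mono) auto
    finally have "sqrt (prob_space.expectation M (\<lambda>\<omega>. (integral {a..b} f - M_alg r z a b m n Q f (\<lambda>l. T l \<omega>))\<^sup>2))
        \<le> sqrt ((\<gamma> * S\<^sup>2 + 5 * \<epsilon> * 4 ^ (r + 1)) * (N / real m ^ r)\<^sup>2 / real n)"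
      by (rule real_sqrt_le_mono)
    also have "\<dots> = N * (sqrt (\<gamma> * S\<^sup>2 + 5 * \<epsilon> * 4 ^ (r + 1)) / (real m ^ r * sqrt (real n)))"
      using N(1) by (simp add: real_sqrt_mult real_sqrt_divide)
    also have "\<dots> \<le> J ^ (r + 1) / fact r / (1 - \<epsilon>) * (sqrt (\<gamma> * S\<^sup>2 + 5 * \<epsilon> * 4 ^ (r + 1)) / (real m ^ r * sqrt (real n)))"
      using N(2) \<gamma>_pos \<epsilon> by (intro mult_right_mono) auto
    finally show "sqrt (prob_space.expectation M (\<lambda>\<omega>. (integral {a..b} f - M_alg r z a b m n Q f (\<lambda>l. T l \<omega>))\<^sup>2))
      \<le> integral {a..b} (\<lambda>x. \<bar>?D x\<bar> powr (1 / (real r + 1))) ^ (r + 1) / fact r / (1 - \<epsilon>)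
        * sqrt (((alpha r z)\<^sup>2 - (beta r z)\<^sup>2) * S\<^sup>2 + 5 * \<epsilon> * 4 ^ (r + 1)) / (real m ^ r * sqrt (real n))"
      by (simp add: J_def \<gamma>_def)
  qed
qed

section \<open>The limit\<close>

lemma nat_floor_linear_asymp:
  fixes c d :: real
  assumes "c > 0"
  shows "(\<lambda>N. real (nat \<lfloor>c * (real N - d)\<rfloor>) / real N) \<longlonglongrightarrow> c"
proof (rule tendsto_sandwich)
  show "(\<lambda>N. (c * (real N - d) - 1) / real N) \<longlonglongrightarrow> c" by real_asymp
  show "(\<lambda>N. c * (real N - d) / real N) \<longlonglongrightarrow> c" by real_asymp
  have ev: "\<forall>\<^sub>F N in sequentially. N > 0 \<and> real N \<ge> d"
    by (intro eventually_conj eventually_gt_at_top) real_asymp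
  show "\<forall>\<^sub>F N in sequentially. (c * (real N - d) - 1) / real N \<le> real (nat \<lfloor>c * (real N - d)\<rfloor>) / real N"
    using ev by eventually_elim (intro divide_right_mono; linarith)
  show "\<forall>\<^sub>F N in sequentially. real (nat \<lfloor>c * (real N - d)\<rfloor>) / real N \<le> c * (real N - d) / real N"
    using ev
  proof eventually_elim
    case (elim N)
    then have "0 \<le> c * (real N - d)" using assms by simp
    then show ?case by (intro divide_right_mono) linarith+
  qed
qed

text \<open>
  The last claim says that the proportions of cells and of samples match \<^const>\<open>c_const\<close>.
  Both cases reduce to one computation, as the proportion of cells is \<open>1 / (r + 1 / 2)\<close> divided by
  \<open>\<theta> = 1 - 1 / r\<close> or by \<open>\<theta> = 1\<close>, and \<^const>\<open>c_const\<close> contains the factor \<open>\<theta> ^ r\<close>.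
\<close>

lemma m_of_n_of_asymp:
  fixes r :: nat and z :: "nat \<Rightarrow> real"
  assumes "r \<ge> 1"
  defines "\<mu> \<equiv> (if both_endpoints r z then 2 * real r / ((real r - 1) * (2 * real r + 1)) else 2 / (2 * real r + 1))"
  shows "(\<lambda>N. real (m_of r z N) / real N) \<longlonglongrightarrow> \<mu>"
    and "(\<lambda>N. real (n_of r z N) / real N) \<longlonglongrightarrow> 1 / (2 * real r + 1)"
    and "\<mu> > 0"
    and "fact r * c_const r z * (\<mu> ^ r * sqrt (1 / (2 * real r + 1))) = 1"
proof -
  define d :: real where "d = (if both_endpoints r z then 1 else 0)"
  show \<mu>: "\<mu> > 0" using assms(1) by (auto simp: \<mu>_def)
  have "m_of r z N = nat \<lfloor>\<mu> * (real N - d)\<rfloor>" for N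
    by (auto simp: m_of_def \<mu>_def d_def)
  then show "(\<lambda>N. real (m_of r z N) / real N) \<longlonglongrightarrow> \<mu>"
    using nat_floor_linear_asymp[OF \<mu>] by simp
  have "n_of r z N = nat \<lfloor>1 / (2 * real r + 1) * (real N - d)\<rfloor>" for N
    by (auto simp: n_of_def d_def)
  then show "(\<lambda>N. real (n_of r z N) / real N) \<longlonglongrightarrow> 1 / (2 * real r + 1)"
    using nat_floor_linear_asymp[of "1 / (2 * real r + 1)"] by simp
  define \<rho> where "\<rho> = real r + 1 / 2"
  have \<rho>: "\<rho> > 0" "2 * real r + 1 = 2 * \<rho>" by (auto simp: \<rho>_def)
  have pw: "(real r + 1 / 2) powr (real r + 1 / 2) = (real r + 1 / 2) ^ r * sqrt (real r + 1 / 2)"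
    by (simp add: powr_add powr_realpow powr_half_sqrt)
  define \<theta> where "\<theta> = (if both_endpoints r z then 1 - 1 / real r else 1)"
  have "\<mu> * \<theta> = 1 / \<rho>"
    using assms(1) \<rho>(1) unfolding \<mu>_def \<theta>_def \<rho>(2) by (auto simp: field_simps)
  then have \<mu>\<theta>: "\<mu> ^ r * \<theta> ^ r = 1 / \<rho> ^ r"
    by (simp add: power_mult_distrib[symmetric] power_one_over)
  have "fact r * c_const r z = sqrt 2 * \<theta> ^ r * (\<rho> ^ r * sqrt \<rho>)"
    unfolding c_const_def \<theta>_def \<rho>_def pw by simp
  then have "fact r * c_const r z * (\<mu> ^ r * sqrt (1 / (2 * real r + 1)))
      = (\<mu> ^ r * \<theta> ^ r) * \<rho> ^ r * (sqrt 2 * sqrt \<rho> * sqrt (1 / (2 * \<rho>)))"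
    unfolding \<rho>(2) by simp
  also have "sqrt 2 * sqrt \<rho> * sqrt (1 / (2 * \<rho>)) = 1"
    using \<rho>(1) by (simp add: real_sqrt_mult[symmetric] real_sqrt_divide)
  finally show "fact r * c_const r z * (\<mu> ^ r * sqrt (1 / (2 * real r + 1))) = 1"
    using \<mu>\<theta> \<rho>(1) by simp
qed

lemma m_of_n_of_at_top:
  assumes "r \<ge> 1"
  shows "filterlim (m_of r z) at_top sequentially" "filterlim (n_of r z) at_top sequentially"
proof -
  have top: "filterlim F at_top sequentially"
    if lim: "(\<lambda>N. real (F N) / real N) \<longlonglongrightarrow> c" and c: "c > 0" for F :: "nat \<Rightarrow> nat" and c :: real
  proof -
    have "filterlim (\<lambda>N. real (F N) / real N * real N) at_top sequentially"
      by (rule filterlim_tendsto_pos_mult_at_top[OF lim c filterlim_real_sequentially])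
    moreover have "\<forall>\<^sub>F N in sequentially. real (F N) / real N * real N = real (F N)"
      using eventually_gt_at_top[of 0] by eventually_elim simp
    ultimately have "filterlim (\<lambda>N. real (F N)) at_top sequentially"
      by (rule filterlim_cong[THEN iffD1, OF refl refl, rotated])
    then show ?thesis by (simp add: filterlim_sequentially_iff_filterlim_real)
  qed
  show "filterlim (m_of r z) at_top sequentially"
    using m_of_n_of_asymp(1,3)[OF assms] by (rule top)
  show "filterlim (n_of r z) at_top sequentially"
    using m_of_n_of_asymp(2)[OF assms] by (rule top) simp
qed

text \<open>Constant vectors are admissible and give the value one.\<close>

lemma K_star_ge_1:
  assumes "(beta r z)\<^sup>2 < (alpha r z)\<^sup>2"
  shows "K_star r z \<ge> 1"
proof -
  define \<gamma> where "\<gamma> = (alpha r z)\<^sup>2 - (beta r z)\<^sup>2"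
  have \<gamma>: "\<gamma> > 0" using assms by (simp add: \<gamma>_def)
  have "(kappa_alpha r z)\<^sup>2 - (kappa_beta r z)\<^sup>2 = (alpha r z)\<^sup>2 / \<gamma> - (beta r z)\<^sup>2 / \<gamma>"
    using \<gamma> by (simp add: kappa_alpha_def kappa_beta_def power_divide flip: \<gamma>_def)
  also have "\<dots> = \<gamma> / \<gamma>" unfolding diff_divide_distrib[symmetric] by (simp add: \<gamma>_def)
  finally have 1: "(kappa_alpha r z)\<^sup>2 - (kappa_beta r z)\<^sup>2 = 1" using \<gamma> by simp
  have one: "(\<lambda>_. 1) \<in> admissible r m" for m
  proof -
    have "(1::real) \<le> 2 ^ (r + 1)" by (rule one_le_power) simp
    then show ?thesis by (auto simp: admissible_def)
  qed
  have "ereal 1 \<le> K_star_ereal r z"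
    unfolding K_star_ereal_def
  proof (rule le_Limsup)
    show "\<forall>\<^sub>F m in sequentially. ereal 1 \<le> (SUP A\<in>admissible r m. ereal (K_mr r z m A))"
      using eventually_ge_at_top[of 1]
      by eventually_elim (intro SUP_upper2[OF one], simp only: K_mr_const 1 real_sqrt_one order_refl)
  qed simp
  then show ?thesis
    using K_star_finite[of r z] unfolding K_star_def by (cases "K_star_ereal r z") auto
qed

lemma K_mr_le_K_star_eventually:
  assumes "\<epsilon> > 0"
  shows "\<forall>\<^sub>F m in sequentially. \<forall>A\<in>admissible r m. K_mr r z m A \<le> K_star r z + \<epsilon>"
proof -
  have "K_star_ereal r z < ereal (K_star r z + \<epsilon>)"
    using K_star_finite[of r z] assms unfolding K_star_def by (cases "K_star_ereal r z") auto
  then have "\<forall>\<^sub>F m in sequentially. (SUP A\<in>admissible r m. ereal (K_mr r z m A)) < ereal (K_star r z + \<epsilon>)"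
    unfolding K_star_ereal_def by (rule Limsup_lessD)
  then show ?thesis
  proof eventually_elim
    case (elim m)
    have "ereal (K_mr r z m A) < ereal (K_star r z + \<epsilon>)" if "A \<in> admissible r m" for A
      using SUP_upper[OF that, of "\<lambda>A. ereal (K_mr r z m A)"] elim by (rule le_less_trans)
    then show ?case by (simp add: less_imp_le)
  qed
qed

theorem theorem4p1:
  fixes r :: nat and a b :: real and z :: "nat \<Rightarrow> real" and f :: "real \<Rightarrow> real"
    and pts :: "ivl \<Rightarrow> nat \<Rightarrow> real"
    and Q :: "nat \<Rightarrow> ivl set"
    and M :: "nat \<Rightarrow> 'w measure"
    and T :: "nat \<Rightarrow> nat \<Rightarrow> 'w \<Rightarrow> real"
  assumes "r \<ge> 1" and "a < b"
    and "0 \<le> z 1" and "strict_mono_on {1..r} z" and "z r \<le> 1"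
    and "C_on r {a..b} f"
    and "(\<forall>x\<in>{a..b}. nderiv_on {a..b} r f x > 0) \<or> (\<forall>x\<in>{a..b}. nderiv_on {a..b} r f x < 0)"
    and pts: "\<And>l u. a \<le> l \<Longrightarrow> l < u \<Longrightarrow> u \<le> b \<Longrightarrow>
      inj_on (pts (l, u)) {0..r} \<and> pts (l, u) ` {0..r} \<subseteq> {l..u}"
    and partition: "\<And>N. m_of r z N \<ge> 1 \<Longrightarrow>
      partition_result (priority r pts f) a b (m_of r z N) (Q N)"
    and "\<And>N. prob_space (M N)"
    and indep: "\<And>N. prob_space.indep_vars (M N) (\<lambda>_. borel) (T N) {1..n_of r z N}"
    and density: "\<And>N l. l \<in> {1..n_of r z N} \<Longrightarrow>
      distributed (M N) lborel (T N l) (\<lambda>x. ennreal (rho a b (m_of r z N) (Q N) x))"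
  shows "lessapprox
    (\<lambda>N. sqrt (prob_space.expectation (M N) (\<lambda>\<omega>.
       (integral {a..b} f - M_alg r z a b (m_of r z N) (n_of r z N) (Q N) f (\<lambda>l. T N l \<omega>))\<^sup>2)))
    (\<lambda>N. K_star r z * c_const r z * sqrt ((alpha r z)\<^sup>2 - (beta r z)\<^sup>2) *
       (integral {a..b} (\<lambda>x. \<bar>nderiv_on {a..b} r f x\<bar> powr (1 / (real r + 1)))) ^ (r + 1) *
       real N powr (- (real r + 1/2)))"
proof -
  let ?D = "nderiv_on {a..b} r f"
  let ?m = "m_of r z" and ?n = "n_of r z"
  have z_inj: "inj_on z {1..r}" using \<open>strict_mono_on {1..r} z\<close> by (rule strict_mono_on_imp_inj_on)
  have z01: "z s \<in> {0..1}" if s: "s \<in> {1..r}" for s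
  proof -
    have "mono_on {1..r} z" using \<open>strict_mono_on {1..r} z\<close> by (rule strict_mono_on_imp_mono_on)
    then have "z 1 \<le> z s" "z s \<le> z r" using s by (auto elim!: mono_onD)
    then show ?thesis using \<open>0 \<le> z 1\<close> \<open>z r \<le> 1\<close> by simp
  qed
  obtain \<sigma> :: real where \<sigma>: "\<bar>\<sigma>\<bar> = 1" "\<And>x. x \<in> {a..b} \<Longrightarrow> \<sigma> * ?D x > 0"
  proof (cases "\<forall>x\<in>{a..b}. ?D x > 0")
    case True
    then show ?thesis by (intro that[of 1]) auto
  next
    case False
    then have "\<forall>x\<in>{a..b}. ?D x < 0" using assms(7) by blast
    then show ?thesis by (intro that[of "-1"]) auto
  qed
  define J where "J = integral {a..b} (\<lambda>x. \<bar>?D x\<bar> powr (1 / (real r + 1)))"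
  define \<gamma> where "\<gamma> = (alpha r z)\<^sup>2 - (beta r z)\<^sup>2"
  define g1 where "g1 N = sqrt (prob_space.expectation (M N) (\<lambda>\<omega>.
       (integral {a..b} f - M_alg r z a b (?m N) (?n N) (Q N) f (\<lambda>l. T N l \<omega>))\<^sup>2))" for N
  define g2 where "g2 N = K_star r z * c_const r z * sqrt \<gamma> * J ^ (r + 1) * real N powr (- (real r + 1/2))" for N
  have "limsup (\<lambda>N. ereal (g1 N / g2 N)) \<le> 1"
  proof (cases "\<gamma> = 0 \<or> J = 0")
    \<comment> \<open>All quotients are divisions by zero, hence zero.\<close>
    case True
    then have "g2 N = 0" for N by (auto simp: g2_def)
    then show ?thesis by (simp add: Limsup_const zero_ereal_def[symmetric])
  next
    case False
    have "\<gamma> \<ge> 0" using alpha_beta_facts(2)[of r z] z01 by (simp add: \<gamma>_def)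
    with False have \<gamma>: "\<gamma> > 0" by simp
    then have less: "(beta r z)\<^sup>2 < (alpha r z)\<^sup>2" by (simp add: \<gamma>_def)
    have K: "K_star r z \<ge> 1" by (rule K_star_ge_1[OF less])
    have "J \<ge> 0" unfolding J_def by (cases "(\<lambda>x. \<bar>?D x\<bar> powr (1 / (real r + 1))) integrable_on {a..b}")
        (auto intro!: integral_nonneg simp: not_integrable_integral)
    with False have J: "J > 0" by simp
    define \<mu> where "\<mu> = (if both_endpoints r z then 2 * real r / ((real r - 1) * (2 * real r + 1)) else 2 / (2 * real r + 1))"
    note asymp = m_of_n_of_asymp[OF \<open>r \<ge> 1\<close>, of z, folded \<mu>_def]
    define c where "c = c_const r z"
    have c: "c > 0"
    proof -
      have "0 < fact r * c * (\<mu> ^ r * sqrt (1 / (2 * real r + 1)))" unfolding c_def asymp(4) by simp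
      moreover have "0 < \<mu> ^ r * sqrt (1 / (2 * real r + 1))" using asymp(3) by (intro mult_pos_pos) auto
      ultimately show ?thesis by (simp add: zero_less_mult_iff)
    qed
    \<comment> \<open>The bound for \<open>m\<close> cells and \<open>n\<close> samples exceeds the claimed one by two factors: \<open>\<tau>\<close> comes from \<open>m\<close>, \<open>n\<close> and \<open>N\<close>,
      and \<open>\<psi>\<close> below from \<open>\<epsilon>\<close>.\<close>
    define \<tau> where "\<tau> N = 1 / (fact r * c * ((real (?m N) / real N) ^ r * sqrt (real (?n N) / real N)))" for N
    have \<tau>: "\<tau> \<longlonglongrightarrow> 1"
    proof -
      have "(\<lambda>N. fact r * c * ((real (?m N) / real N) ^ r * sqrt (real (?n N) / real N)))
          \<longlonglongrightarrow> fact r * c * (\<mu> ^ r * sqrt (1 / (2 * real r + 1)))"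
        by (intro tendsto_mult tendsto_const tendsto_power tendsto_real_sqrt asymp(1,2))
      from tendsto_divide[OF tendsto_const this[unfolded c_def asymp(4)], of 1]
      show ?thesis by (simp add: \<tau>_def[abs_def] c_def)
    qed
    define \<psi> where "\<psi> \<epsilon> = sqrt (\<gamma> * (K_star r z + \<epsilon>)\<^sup>2 + 5 * \<epsilon> * 4 ^ (r + 1)) / (1 - \<epsilon>) / (K_star r z * sqrt \<gamma>)" for \<epsilon>
    have bound: "limsup (\<lambda>N. ereal (g1 N / g2 N)) \<le> ereal (\<psi> \<epsilon>)" if \<epsilon>: "0 < \<epsilon>" "\<epsilon> < 1" for \<epsilon>
    proof -
      obtain m0 where m0: "\<And>m n Q (M :: 'w measure) T S. m \<ge> m0 \<Longrightarrow> n \<ge> 1 \<Longrightarrow>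
          partition_result (priority r pts f) a b m Q \<Longrightarrow> prob_space M \<Longrightarrow>
          prob_space.indep_vars M (\<lambda>_. borel) T {1..n} \<Longrightarrow>
          (\<forall>l\<in>{1..n}. distributed M lborel (T l) (\<lambda>x. ennreal (rho a b m Q x))) \<Longrightarrow>
          (\<forall>A\<in>admissible r m. K_mr r z m A \<le> S) \<Longrightarrow>
          sqrt (prob_space.expectation M (\<lambda>\<omega>. (integral {a..b} f - M_alg r z a b m n Q f (\<lambda>l. T l \<omega>))\<^sup>2))
          \<le> J ^ (r + 1) / fact r / (1 - \<epsilon>) * sqrt (\<gamma> * S\<^sup>2 + 5 * \<epsilon> * 4 ^ (r + 1)) / (real m ^ r * sqrt (real n))"
        using rms_error_le[OF assms(1,2) z_inj z01 assms(6) \<sigma> pts less \<epsilon>, where ?'w = 'w]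
        unfolding J_def \<gamma>_def by blast
      note m_top = m_of_n_of_at_top(1)[OF \<open>r \<ge> 1\<close>, of z] and n_top = m_of_n_of_at_top(2)[OF \<open>r \<ge> 1\<close>, of z]
      have "\<forall>\<^sub>F N in sequentially. g1 N / g2 N \<le> \<tau> N * \<psi> \<epsilon>"
        using eventually_gt_at_top[of 0] filterlim_at_top[THEN iffD1, OF m_top, rule_format, of "max 1 m0"]
          filterlim_at_top[THEN iffD1, OF n_top, rule_format, of 1]
          eventually_compose_filterlim[OF K_mr_le_K_star_eventually[OF \<epsilon>(1), of r z] m_top]
      proof eventually_elim
        case (elim N)
        have g1: "g1 N \<le> J ^ (r + 1) / fact r / (1 - \<epsilon>) * sqrt (\<gamma> * (K_star r z + \<epsilon>)\<^sup>2 + 5 * \<epsilon> * 4 ^ (r + 1))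
            / (real (?m N) ^ r * sqrt (real (?n N)))"
          unfolding g1_def using elim assms(10) partition[of N] indep density
          by (intro m0) auto
        have "real N powr (real r + 1 / 2) = real N ^ r * sqrt (real N)"
          using elim by (simp add: powr_add powr_realpow powr_half_sqrt)
        then have N: "real N powr (- (real r + 1 / 2)) = 1 / (real N ^ r * sqrt (real N))"
          by (simp only: powr_minus inverse_eq_divide)
        have g2: "g2 N > 0"
          unfolding g2_def using K c \<gamma> J elim by (simp add: c_def)
        have mn: "real (?m N) > 0" "real (?n N) > 0" "real N > 0" using elim by auto
        have "g1 N / g2 N \<le> J ^ (r + 1) / fact r / (1 - \<epsilon>) * sqrt (\<gamma> * (K_star r z + \<epsilon>)\<^sup>2 + 5 * \<epsilon> * 4 ^ (r + 1))
            / (real (?m N) ^ r * sqrt (real (?n N))) / g2 N"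
          using g1 g2 by (intro divide_right_mono) auto
        also have "\<dots> = \<tau> N * \<psi> \<epsilon>"
          unfolding \<tau>_def \<psi>_def g2_def N c_def[symmetric] using mn J c K \<gamma> \<epsilon>
          by (simp add: field_simps power_divide real_sqrt_divide)
        finally show ?case .
      qed
      then have "\<forall>\<^sub>F N in sequentially. ereal (g1 N / g2 N) \<le> ereal (\<tau> N * \<psi> \<epsilon>)" by simp
      then have "limsup (\<lambda>N. ereal (g1 N / g2 N)) \<le> limsup (\<lambda>N. ereal (\<tau> N * \<psi> \<epsilon>))"
        by (rule Limsup_mono)
      also have "limsup (\<lambda>N. ereal (\<tau> N * \<psi> \<epsilon>)) = ereal (1 * \<psi> \<epsilon>)"
        by (intro lim_imp_Limsup tendsto_ereal tendsto_mult tendsto_const \<tau>) simp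
      finally show ?thesis by simp
    qed
    have "(\<psi> \<longlongrightarrow> \<psi> 0) (at_right 0)"
      unfolding \<psi>_def[abs_def] using K \<gamma> by (intro tendsto_intros) auto
    moreover have "\<psi> 0 = 1" using K \<gamma> by (simp add: \<psi>_def real_sqrt_mult)
    ultimately have "((\<lambda>\<epsilon>. ereal (\<psi> \<epsilon>)) \<longlongrightarrow> ereal 1) (at_right 0)" by simp
    moreover have "\<forall>\<^sub>F \<epsilon> in at_right 0. limsup (\<lambda>N. ereal (g1 N / g2 N)) \<le> ereal (\<psi> \<epsilon>)"
      using eventually_at_right_real[of 0 "1::real"] by (auto elim!: eventually_mono intro!: bound)
    ultimately have "limsup (\<lambda>N. ereal (g1 N / g2 N)) \<le> ereal 1"
      by (rule tendsto_lowerbound) simp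
    then show ?thesis by (simp add: one_ereal_def)
  qed
  then show ?thesis
    unfolding lessapprox_def g1_def g2_def J_def \<gamma>_def .
qed

end
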